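(* Let $A$ be a Lie algebra over a field $k$ and let $B$ and $C$ be $A$-Lie algebras. Then $B$ and $C$ are geometrically equivalent if and only if $(A\text{-}\mathrm{pvar}(B))_\omega=(A\text{-}\mathrm{pvar}(C))_\omega$.
   Context: An $A$-Lie algebra is a Lie algebra $B$ over $k$ together with a fixed injective Lie algebra homomorphism $A\to B$, via which $A$ is identified with a subalgebra of $B$. An $A$-homomorphism is a homomorphism of Lie algebras that is the identity on $A$. An $A$-subalgebra is a subalgebra containing $A$. An $A$-Lie algebra is finitely generated if it is generated, as a Lie algebra, by $A$ together with a finite set. For $X=\{x_1,\dots,x_n\}$, $A[X]=A*F(X)$ is the free Lie product of $A$ and the free Lie $k$-algebra $F(X)$. For $f\in A[X]$ and $p=(b_1,\dots,b_n)\in B^n$, $f(p)$ is the image of $f$ under the $A$-homomorphism $A[X]\to B$ with $x_i\mapsto b_i$. For $S\subseteq A[X]$, $V_B(S)=\{p\in B^n : f(p)=0\ \forall f\in S\}$ and $\mathrm{Rad}_B(S)=\{f\in A[X] : f(p)=0\ \forall p\in V_B(S)\}$ (equal to $A[X]$ if $V_B(S)=\emptyset$). $B$ and $C$ are geometrically equivalent if for every positive integer $n$ and every $S\subseteq A[x_1,\dots,x_n]$ one has $\mathrm{Rad}_B(S)=\mathrm{Rad}_C(S)$. For a class $\mathcal K$ of $A$-Lie algebras, $A\text{-}\mathrm{pvar}(\mathcal K)=S_AP_A(\mathcal K)$ is the class of all $A$-Lie algebras $A$-isomorphic to $A$-subalgebras of unrestricted cartesian products $\prod_{i\in I}B_i$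 with $B_i\in\mathcal K$, where $A$ is embedded diagonally (the index set $I$ is nonempty unless $A=0$). $A\text{-}\mathrm{pvar}(B)$ means $A\text{-}\mathrm{pvar}(\{B\})$. For a class $\mathcal K$ closed under $A$-subalgebras, $\mathcal K_\omega$ denotes the class of all finitely generated $A$-Lie algebras in $\mathcal K$. *)

theory Defs
  imports "HOL-Algebra.Module" "HOL-Library.FuncSet" "HOL-Library.Equipollence"
begin

section \<open>Lie algebras over a field\<close>

text \<open>
  A Lie algebra is a module record whose multiplication field is the Lie bracket
  (as in the locale \<^locale>\<open>algebra\<close>, but neither associative nor commutative).
  The field \<^const>\<open>one\<close> of the record carries no information.
\<close>

locale lie_algebra = K?: field K + L?: module K L
  for K (structure) and L (structure) +
  assumes bracket_closed [simp, intro]: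
      "\<lbrakk>x \<in> carrier L; y \<in> carrier L\<rbrakk> \<Longrightarrow> x \<otimes>\<^bsub>L\<^esub> y \<in> carrier L"
    and bracket_add_left:
      "\<lbrakk>x \<in> carrier L; y \<in> carrier L; z \<in> carrier L\<rbrakk> \<Longrightarrow>
        (x \<oplus>\<^bsub>L\<^esub> y) \<otimes>\<^bsub>L\<^esub> z = x \<otimes>\<^bsub>L\<^esub> z \<oplus>\<^bsub>L\<^esub> y \<otimes>\<^bsub>L\<^esub> z"
    and bracket_add_right:
      "\<lbrakk>x \<in> carrier L; y \<in> carrier L; z \<in> carrier L\<rbrakk> \<Longrightarrow>
        x \<otimes>\<^bsub>L\<^esub> (y \<oplus>\<^bsub>L\<^esub> z) = x \<otimes>\<^bsub>L\<^esub> y \<oplus>\<^bsub>L\<^esub> x \<otimes>\<^bsub>L\<^esub> z"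
    and bracket_smult_left:
      "\<lbrakk>c \<in> carrier K; x \<in> carrier L; y \<in> carrier L\<rbrakk> \<Longrightarrow>
        (c \<odot>\<^bsub>L\<^esub> x) \<otimes>\<^bsub>L\<^esub> y = c \<odot>\<^bsub>L\<^esub> (x \<otimes>\<^bsub>L\<^esub> y)"
    and bracket_smult_right:
      "\<lbrakk>c \<in> carrier K; x \<in> carrier L; y \<in> carrier L\<rbrakk> \<Longrightarrow>
        x \<otimes>\<^bsub>L\<^esub> (c \<odot>\<^bsub>L\<^esub> y) = c \<odot>\<^bsub>L\<^esub> (x \<otimes>\<^bsub>L\<^esub> y)"
    and bracket_self:
      "x \<in> carrier L \<Longrightarrow> x \<otimes>\<^bsub>L\<^esub> x = \<zero>\<^bsub>L\<^esub>"
    and jacobi: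
      "\<lbrakk>x \<in> carrier L; y \<in> carrier L; z \<in> carrier L\<rbrakk> \<Longrightarrow>
        (x \<otimes>\<^bsub>L\<^esub> (y \<otimes>\<^bsub>L\<^esub> z)) \<oplus>\<^bsub>L\<^esub> (y \<otimes>\<^bsub>L\<^esub> (z \<otimes>\<^bsub>L\<^esub> x)) \<oplus>\<^bsub>L\<^esub> (z \<otimes>\<^bsub>L\<^esub> (x \<otimes>\<^bsub>L\<^esub> y)) = \<zero>\<^bsub>L\<^esub>"

definition lie_hom ::
    "('k, 'm) ring_scheme \<Rightarrow> ('k, 'a, 'n) module_scheme \<Rightarrow> ('k, 'b, 'p) module_scheme \<Rightarrow> ('a \<Rightarrow> 'b) set"
  where "lie_hom K L M =
    {h \<in> carrier L \<rightarrow> carrier M.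
      (\<forall>x\<in>carrier L. \<forall>y\<in>carrier L. h (x \<oplus>\<^bsub>L\<^esub> y) = h x \<oplus>\<^bsub>M\<^esub> h y) \<and>
      (\<forall>c\<in>carrier K. \<forall>x\<in>carrier L. h (c \<odot>\<^bsub>L\<^esub> x) = c \<odot>\<^bsub>M\<^esub> h x) \<and>
      (\<forall>x\<in>carrier L. \<forall>y\<in>carrier L. h (x \<otimes>\<^bsub>L\<^esub> y) = h x \<otimes>\<^bsub>M\<^esub> h y)}"

definition lie_subalgebra ::
    "('k, 'm) ring_scheme \<Rightarrow> ('k, 'a, 'n) module_scheme \<Rightarrow> 'a set \<Rightarrow> bool"
  where "lie_subalgebra K L H \<longleftrightarrow>
    submodule H K L \<and> (\<forall>x\<in>H. \<forall>y\<in>H. x \<otimes>\<^bsub>L\<^esub> y \<in> H)"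

definition lie_span ::
    "('k, 'm) ring_scheme \<Rightarrow> ('k, 'a, 'n) module_scheme \<Rightarrow> 'a set \<Rightarrow> 'a set"
  where "lie_span K L T = \<Inter> {H. lie_subalgebra K L H \<and> T \<subseteq> H}"


section \<open>Presentations, free Lie algebras and free Lie products\<close>

datatype ('k, 'g) lie_term =
    LGen 'g
  | LZero
  | LAdd "('k, 'g) lie_term" "('k, 'g) lie_term"
  | LSmult 'k "('k, 'g) lie_term"
  | LBr "('k, 'g) lie_term" "('k, 'g) lie_term"

inductive_set lie_terms :: "('k, 'm) ring_scheme \<Rightarrow> 'g set \<Rightarrow> ('k, 'g) lie_term set"
  for K :: "('k, 'm) ring_scheme" and G :: "'g set"
  where
    gen: "g \<in> G \<Longrightarrow> LGen g \<in> lie_terms K G"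
  | zero: "LZero \<in> lie_terms K G"
  | add: "\<lbrakk>s \<in> lie_terms K G; t \<in> lie_terms K G\<rbrakk> \<Longrightarrow> LAdd s t \<in> lie_terms K G"
  | smult: "\<lbrakk>c \<in> carrier K; t \<in> lie_terms K G\<rbrakk> \<Longrightarrow> LSmult c t \<in> lie_terms K G"
  | br: "\<lbrakk>s \<in> lie_terms K G; t \<in> lie_terms K G\<rbrakk> \<Longrightarrow> LBr s t \<in> lie_terms K G"

text \<open>
  The least congruence on the terms over \<open>G\<close> that contains \<open>R\<close> and whose quotient
  satisfies the axioms of a Lie algebra.
\<close>

inductive_set lie_cong ::
    "('k, 'm) ring_scheme \<Rightarrow> 'g set \<Rightarrow> (('k, 'g) lie_term \<times> ('k, 'g) lie_term) set
      \<Rightarrow> (('k, 'g) lie_term \<times> ('k, 'g) lie_term) set"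
  for K :: "('k, 'm) ring_scheme" and G :: "'g set"
    and R :: "(('k, 'g) lie_term \<times> ('k, 'g) lie_term) set"
  where
    rel: "\<lbrakk>(s, t) \<in> R; s \<in> lie_terms K G; t \<in> lie_terms K G\<rbrakk> \<Longrightarrow> (s, t) \<in> lie_cong K G R"
  | refl: "s \<in> lie_terms K G \<Longrightarrow> (s, s) \<in> lie_cong K G R"
  | sym: "(s, t) \<in> lie_cong K G R \<Longrightarrow> (t, s) \<in> lie_cong K G R"
  | trans: "\<lbrakk>(s, t) \<in> lie_cong K G R; (t, u) \<in> lie_cong K G R\<rbrakk> \<Longrightarrow> (s, u) \<in> lie_cong K G R"
  | cong_add: "\<lbrakk>(s, s') \<in> lie_cong K G R; (t, t') \<in> lie_cong K G R\<rbrakk>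
      \<Longrightarrow> (LAdd s t, LAdd s' t') \<in> lie_cong K G R"
  | cong_smult: "\<lbrakk>c \<in> carrier K; (t, t') \<in> lie_cong K G R\<rbrakk>
      \<Longrightarrow> (LSmult c t, LSmult c t') \<in> lie_cong K G R"
  | cong_br: "\<lbrakk>(s, s') \<in> lie_cong K G R; (t, t') \<in> lie_cong K G R\<rbrakk>
      \<Longrightarrow> (LBr s t, LBr s' t') \<in> lie_cong K G R"
  | add_assoc: "\<lbrakk>s \<in> lie_terms K G; t \<in> lie_terms K G; u \<in> lie_terms K G\<rbrakk>
      \<Longrightarrow> (LAdd (LAdd s t) u, LAdd s (LAdd t u)) \<in> lie_cong K G R"
  | add_comm: "\<lbrakk>s \<in> lie_terms K G; t \<in> lie_terms K G\<rbrakk>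
      \<Longrightarrow> (LAdd s t, LAdd t s) \<in> lie_cong K G R"
  | add_zero: "s \<in> lie_terms K G \<Longrightarrow> (LAdd LZero s, s) \<in> lie_cong K G R"
  | add_neg: "s \<in> lie_terms K G
      \<Longrightarrow> (LAdd (LSmult (\<ominus>\<^bsub>K\<^esub> \<one>\<^bsub>K\<^esub>) s) s, LZero) \<in> lie_cong K G R"
  | smult_add_left: "\<lbrakk>c \<in> carrier K; d \<in> carrier K; s \<in> lie_terms K G\<rbrakk>
      \<Longrightarrow> (LSmult (c \<oplus>\<^bsub>K\<^esub> d) s, LAdd (LSmult c s) (LSmult d s)) \<in> lie_cong K G R"
  | smult_add_right: "\<lbrakk>c \<in> carrier K; s \<in> lie_terms K G; t \<in> lie_terms K G\<rbrakk>
      \<Longrightarrow> (LSmult c (LAdd s t), LAdd (LSmult c s) (LSmult c t)) \<in> lie_cong K G R"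
  | smult_assoc: "\<lbrakk>c \<in> carrier K; d \<in> carrier K; s \<in> lie_terms K G\<rbrakk>
      \<Longrightarrow> (LSmult (c \<otimes>\<^bsub>K\<^esub> d) s, LSmult c (LSmult d s)) \<in> lie_cong K G R"
  | smult_one: "s \<in> lie_terms K G \<Longrightarrow> (LSmult \<one>\<^bsub>K\<^esub> s, s) \<in> lie_cong K G R"
  | br_add_left: "\<lbrakk>s \<in> lie_terms K G; t \<in> lie_terms K G; u \<in> lie_terms K G\<rbrakk>
      \<Longrightarrow> (LBr (LAdd s t) u, LAdd (LBr s u) (LBr t u)) \<in> lie_cong K G R"
  | br_add_right: "\<lbrakk>s \<in> lie_terms K G; t \<in> lie_terms K G; u \<in> lie_terms K G\<rbrakk>
      \<Longrightarrow> (LBr s (LAdd t u), LAdd (LBr s t) (LBr s u)) \<in> lie_cong K G R"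
  | br_smult_left: "\<lbrakk>c \<in> carrier K; s \<in> lie_terms K G; t \<in> lie_terms K G\<rbrakk>
      \<Longrightarrow> (LBr (LSmult c s) t, LSmult c (LBr s t)) \<in> lie_cong K G R"
  | br_smult_right: "\<lbrakk>c \<in> carrier K; s \<in> lie_terms K G; t \<in> lie_terms K G\<rbrakk>
      \<Longrightarrow> (LBr s (LSmult c t), LSmult c (LBr s t)) \<in> lie_cong K G R"
  | br_self: "s \<in> lie_terms K G \<Longrightarrow> (LBr s s, LZero) \<in> lie_cong K G R"
  | br_jacobi: "\<lbrakk>s \<in> lie_terms K G; t \<in> lie_terms K G; u \<in> lie_terms K G\<rbrakk>
      \<Longrightarrow> (LAdd (LAdd (LBr s (LBr t u)) (LBr t (LBr u s))) (LBr u (LBr s t)), LZero)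
            \<in> lie_cong K G R"

definition lie_class ::
    "('k, 'm) ring_scheme \<Rightarrow> 'g set \<Rightarrow> (('k, 'g) lie_term \<times> ('k, 'g) lie_term) set
      \<Rightarrow> ('k, 'g) lie_term \<Rightarrow> ('k, 'g) lie_term set"
  where "lie_class K G R t = lie_cong K G R `` {t}"

definition presented_lie ::
    "('k, 'm) ring_scheme \<Rightarrow> 'g set \<Rightarrow> (('k, 'g) lie_term \<times> ('k, 'g) lie_term) set
      \<Rightarrow> ('k, ('k, 'g) lie_term set) module"
  where "presented_lie K G R =
    \<lparr>carrier = lie_terms K G // lie_cong K G R,
     mult = (\<lambda>x y. \<Union>s\<in>x. \<Union>t\<in>y. lie_class K G R (LBr s t)),
     one = undefined,
     zero = lie_class K G R LZero,
     add = (\<lambda>x y. \<Union>s\<in>x. \<Union>t\<in>y. lie_class K G R (LAdd s t)),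
     smult = (\<lambda>c x. \<Union>t\<in>x. lie_class K G R (LSmult c t))\<rparr>"

definition free_lie :: "('k, 'm) ring_scheme \<Rightarrow> 'g set \<Rightarrow> ('k, ('k, 'g) lie_term set) module"
  where "free_lie K X = presented_lie K X {}"

definition free_lie_var :: "('k, 'm) ring_scheme \<Rightarrow> 'g set \<Rightarrow> 'g \<Rightarrow> ('k, 'g) lie_term set"
  where "free_lie_var K X x = lie_class K X {} (LGen x)"

definition table_rels ::
    "('k, 'm) ring_scheme \<Rightarrow> ('k, 'a, 'n) module_scheme \<Rightarrow> ('a \<Rightarrow> 'g)
      \<Rightarrow> (('k, 'g) lie_term \<times> ('k, 'g) lie_term) set"
  where "table_rels K L j =
    {(LAdd (LGen (j x)) (LGen (j y)), LGen (j (x \<oplus>\<^bsub>L\<^esub> y))) | x y. x \<in> carrier L \<and> y \<in> carrier L} \<union>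
    {(LSmult c (LGen (j x)), LGen (j (c \<odot>\<^bsub>L\<^esub> x))) | c x. c \<in> carrier K \<and> x \<in> carrier L} \<union>
    {(LBr (LGen (j x)) (LGen (j y)), LGen (j (x \<otimes>\<^bsub>L\<^esub> y))) | x y. x \<in> carrier L \<and> y \<in> carrier L}"

text \<open>
  The free Lie product (coproduct) of two Lie algebras, generated by the disjoint union of
  their carriers subject to the operation tables of both factors; see
  \<open>lie_free_product_universal\<close> below.
\<close>

definition free_product_gens ::
    "('k, 'a, 'n) module_scheme \<Rightarrow> ('k, 'b, 'p) module_scheme \<Rightarrow> ('a + 'b) set"
  where "free_product_gens L M = carrier L <+> carrier M"

definition free_product_rels ::
    "('k, 'm) ring_scheme \<Rightarrow> ('k, 'a, 'n) module_scheme \<Rightarrow> ('k, 'b, 'p) module_scheme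
      \<Rightarrow> (('k, 'a + 'b) lie_term \<times> ('k, 'a + 'b) lie_term) set"
  where "free_product_rels K L M = table_rels K L Inl \<union> table_rels K M Inr"

definition lie_free_product ::
    "('k, 'm) ring_scheme \<Rightarrow> ('k, 'a, 'n) module_scheme \<Rightarrow> ('k, 'b, 'p) module_scheme
      \<Rightarrow> ('k, ('k, 'a + 'b) lie_term set) module"
  where "lie_free_product K L M =
    presented_lie K (free_product_gens L M) (free_product_rels K L M)"

definition free_product_inl ::
    "('k, 'm) ring_scheme \<Rightarrow> ('k, 'a, 'n) module_scheme \<Rightarrow> ('k, 'b, 'p) module_scheme
      \<Rightarrow> 'a \<Rightarrow> ('k, 'a + 'b) lie_term set"
  where "free_product_inl K L M x =
    lie_class K (free_product_gens L M) (free_product_rels K L M) (LGen (Inl x))"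

definition free_product_inr ::
    "('k, 'm) ring_scheme \<Rightarrow> ('k, 'a, 'n) module_scheme \<Rightarrow> ('k, 'b, 'p) module_scheme
      \<Rightarrow> 'b \<Rightarrow> ('k, 'a + 'b) lie_term set"
  where "free_product_inr K L M y =
    lie_class K (free_product_gens L M) (free_product_rels K L M) (LGen (Inr y))"


subsection \<open>Universal properties\<close>

lemma lie_hom_closed: "\<lbrakk>h \<in> lie_hom K L M; x \<in> carrier L\<rbrakk> \<Longrightarrow> h x \<in> carrier M"
  by (auto simp: lie_hom_def)

lemma lie_hom_add:
  "\<lbrakk>h \<in> lie_hom K L M; x \<in> carrier L; y \<in> carrier L\<rbrakk> \<Longrightarrow> h (x \<oplus>\<^bsub>L\<^esub> y) = h x \<oplus>\<^bsub>M\<^esub> h y"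
  by (auto simp: lie_hom_def)

lemma lie_hom_smult:
  "\<lbrakk>h \<in> lie_hom K L M; c \<in> carrier K; x \<in> carrier L\<rbrakk> \<Longrightarrow> h (c \<odot>\<^bsub>L\<^esub> x) = c \<odot>\<^bsub>M\<^esub> h x"
  by (auto simp: lie_hom_def)

lemma lie_hom_bracket:
  "\<lbrakk>h \<in> lie_hom K L M; x \<in> carrier L; y \<in> carrier L\<rbrakk> \<Longrightarrow> h (x \<otimes>\<^bsub>L\<^esub> y) = h x \<otimes>\<^bsub>M\<^esub> h y"
  by (auto simp: lie_hom_def)

lemma lie_hom_zero:
  assumes "lie_algebra K L" "lie_algebra K M" "h \<in> lie_hom K L M"
  shows "h \<zero>\<^bsub>L\<^esub> = \<zero>\<^bsub>M\<^esub>"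
proof -
  interpret L: lie_algebra K L by fact
  interpret M: lie_algebra K M by fact
  have "h (\<zero>\<^bsub>K\<^esub> \<odot>\<^bsub>L\<^esub> \<zero>\<^bsub>L\<^esub>) = \<zero>\<^bsub>K\<^esub> \<odot>\<^bsub>M\<^esub> h \<zero>\<^bsub>L\<^esub>"
    using assms(3) by (intro lie_hom_smult) auto
  then show ?thesis
    using lie_hom_closed[OF assms(3) L.M.zero_closed] by simp
qed

lemma lie_hom_comp:
  assumes "g \<in> lie_hom K L M" "h \<in> lie_hom K M N"
  shows "h \<circ> g \<in> lie_hom K L N"
  using assms by (auto simp: lie_hom_def Pi_iff)

lemma lie_cong_terms:
  assumes "cring K" "(s, t) \<in> lie_cong K G R"
  shows "s \<in> lie_terms K G \<and> t \<in> lie_terms K G"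
proof -
  interpret cring K by fact
  show ?thesis
    using assms(2) by induction (auto intro!: lie_terms.intros)
qed

lemma lie_cong_equiv:
  assumes "cring K"
  shows "equiv (lie_terms K G) (lie_cong K G R)"
  by (rule equivI)
     (auto simp: refl_on_def sym_def trans_def
       intro: lie_cong.refl lie_cong.sym lie_cong.trans dest: lie_cong_terms[OF assms])

lemma lie_class_eq_iff:
  assumes "cring K" "s \<in> lie_terms K G" "t \<in> lie_terms K G"
  shows "lie_class K G R s = lie_class K G R t \<longleftrightarrow> (s, t) \<in> lie_cong K G R"
  unfolding lie_class_def
  using eq_equiv_class_iff[OF lie_cong_equiv[OF assms(1)] assms(2,3)] .

lemma lie_class_eqI:
  assumes "cring K" "(s, t) \<in> lie_cong K G R"
  shows "lie_class K G R s = lie_class K G R t"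
  unfolding lie_class_def by (rule equiv_class_eq[OF lie_cong_equiv[OF assms(1)] assms(2)])

lemma presented_carrier:
  "carrier (presented_lie K G R) = lie_class K G R ` lie_terms K G"
  by (auto simp: presented_lie_def quotient_def lie_class_def)

lemma presented_zero: "\<zero>\<^bsub>presented_lie K G R\<^esub> = lie_class K G R LZero"
  by (simp add: presented_lie_def)

lemma presented_add:
  assumes "cring K" "s \<in> lie_terms K G" "t \<in> lie_terms K G"
  shows "lie_class K G R s \<oplus>\<^bsub>presented_lie K G R\<^esub> lie_class K G R t = lie_class K G R (LAdd s t)"
proof -
  note E = lie_cong_equiv[OF assms(1), of G R]
  have "congruent2 (lie_cong K G R) (lie_cong K G R) (\<lambda>s t. lie_class K G R (LAdd s t))"
    unfolding lie_class_def
    by (intro congruent2I' equiv_class_eq[OF E] lie_cong.cong_add)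
  from UN_equiv_class2[OF E E this assms(2,3)] show ?thesis
    by (simp add: presented_lie_def lie_class_def)
qed

lemma presented_bracket:
  assumes "cring K" "s \<in> lie_terms K G" "t \<in> lie_terms K G"
  shows "lie_class K G R s \<otimes>\<^bsub>presented_lie K G R\<^esub> lie_class K G R t = lie_class K G R (LBr s t)"
proof -
  note E = lie_cong_equiv[OF assms(1), of G R]
  have "congruent2 (lie_cong K G R) (lie_cong K G R) (\<lambda>s t. lie_class K G R (LBr s t))"
    unfolding lie_class_def
    by (intro congruent2I' equiv_class_eq[OF E] lie_cong.cong_br)
  from UN_equiv_class2[OF E E this assms(2,3)] show ?thesis
    by (simp add: presented_lie_def lie_class_def)
qed

lemma presented_smult:
  assumes "cring K" "c \<in> carrier K" "t \<in> lie_terms K G"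
  shows "c \<odot>\<^bsub>presented_lie K G R\<^esub> lie_class K G R t = lie_class K G R (LSmult c t)"
proof -
  note E = lie_cong_equiv[OF assms(1), of G R]
  have "congruent (lie_cong K G R) (\<lambda>t. lie_class K G R (LSmult c t))"
    unfolding lie_class_def
    by (intro congruentI equiv_class_eq[OF E] lie_cong.cong_smult assms(2))
  from UN_equiv_class[OF E this assms(3)] show ?thesis
    by (simp add: presented_lie_def lie_class_def)
qed

lemma presented_lie_algebra:
  assumes "field K"
  shows "lie_algebra K (presented_lie K G R)"
proof -
  interpret K: field K by fact
  have cr: "cring K" by (rule K.is_cring)
  note ops = presented_carrier presented_zero presented_add[OF cr] presented_bracket[OF cr]
    presented_smult[OF cr]
  note tms = lie_terms.intros
  let ?P = "presented_lie K G R"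
  have ab: "abelian_group ?P"
  proof (rule abelian_groupI)
    fix x assume "x \<in> carrier ?P"
    then obtain s where s: "s \<in> lie_terms K G" "x = lie_class K G R s"
      by (auto simp: ops)
    have "LSmult (\<ominus>\<^bsub>K\<^esub> \<one>\<^bsub>K\<^esub>) s \<in> lie_terms K G"
      using s by (intro tms) auto
    then show "\<exists>y\<in>carrier ?P. y \<oplus>\<^bsub>?P\<^esub> x = \<zero>\<^bsub>?P\<^esub>"
      using s by (intro bexI[of _ "lie_class K G R (LSmult (\<ominus>\<^bsub>K\<^esub> \<one>\<^bsub>K\<^esub>) s)"])
        (simp_all add: ops lie_class_eq_iff[OF cr] tms lie_cong.add_neg)
  qed (auto simp: ops lie_class_eq_iff[OF cr] tms lie_cong.intros(8-) del: equalityI)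
  have "module K ?P"
    by (rule moduleI[OF cr ab])
       (auto simp: ops lie_class_eq_iff[OF cr] tms lie_cong.intros(8-) del: equalityI)
  then show ?thesis
    by (intro lie_algebra.intro lie_algebra_axioms.intro assms)
       (auto simp: ops lie_class_eq_iff[OF cr] tms lie_cong.intros(8-) del: equalityI)
qed

primrec term_eval ::
    "('k, 'b, 'p) module_scheme \<Rightarrow> ('g \<Rightarrow> 'b) \<Rightarrow> ('k, 'g) lie_term \<Rightarrow> 'b"
  where
    "term_eval L v (LGen g) = v g"
  | "term_eval L v LZero = \<zero>\<^bsub>L\<^esub>"
  | "term_eval L v (LAdd s t) = term_eval L v s \<oplus>\<^bsub>L\<^esub> term_eval L v t"
  | "term_eval L v (LSmult c t) = c \<odot>\<^bsub>L\<^esub> term_eval L v t"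
  | "term_eval L v (LBr s t) = term_eval L v s \<otimes>\<^bsub>L\<^esub> term_eval L v t"

lemma term_eval_closed:
  assumes "lie_algebra K L" "v \<in> G \<rightarrow> carrier L" "t \<in> lie_terms K G"
  shows "term_eval L v t \<in> carrier L"
proof -
  interpret lie_algebra K L by fact
  show ?thesis
    using assms(3) by induction (use assms(2) in auto)
qed

lemma term_eval_cong:
  assumes "lie_algebra K L" "v \<in> G \<rightarrow> carrier L"
    and R: "\<And>s t. \<lbrakk>(s, t) \<in> R; s \<in> lie_terms K G; t \<in> lie_terms K G\<rbrakk>
              \<Longrightarrow> term_eval L v s = term_eval L v t"
    and "(s, t) \<in> lie_cong K G R"
  shows "term_eval L v s = term_eval L v t"
proof -
  interpret lie_algebra K L by fact
  note cl = term_eval_closed[OF assms(1,2)]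
  have neg: "(\<ominus>\<^bsub>K\<^esub> \<one>\<^bsub>K\<^esub>) \<odot>\<^bsub>L\<^esub> x \<oplus>\<^bsub>L\<^esub> x = \<zero>\<^bsub>L\<^esub>" if "x \<in> carrier L" for x
    using that by (simp add: smult_l_minus M.l_neg)
  show ?thesis
    using assms(4)
  proof induction
    case (add_assoc s t u) then show ?case by (simp add: cl M.a_assoc)
  next
    case (add_comm s t) then show ?case by (simp add: cl M.a_comm)
  next
    case (br_jacobi s t u) then show ?case by (simp add: cl jacobi)
  qed (simp_all add: cl R neg smult_l_distr smult_r_distr smult_assoc1 bracket_add_left
        bracket_add_right bracket_smult_left bracket_smult_right bracket_self)
qed

lemma presented_universal:
  assumes "lie_algebra K L" "v \<in> G \<rightarrow> carrier L"
    and R: "\<And>s t. \<lbrakk>(s, t) \<in> R; s \<in> lie_terms K G; t \<in> lie_terms K G\<rbrakk>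
              \<Longrightarrow> term_eval L v s = term_eval L v t"
  shows "\<exists>h\<in>lie_hom K (presented_lie K G R) L.
           \<forall>t\<in>lie_terms K G. h (lie_class K G R t) = term_eval L v t"
proof -
  interpret lie_algebra K L by fact
  have cr: "cring K" by (rule K.is_cring)
  note cl = term_eval_closed[OF assms(1,2)]
  define h where "h x = term_eval L v (SOME t. t \<in> lie_terms K G \<and> x = lie_class K G R t)" for x
  have h: "h (lie_class K G R t) = term_eval L v t" if t: "t \<in> lie_terms K G" for t
  proof -
    let ?s = "SOME s. s \<in> lie_terms K G \<and> lie_class K G R t = lie_class K G R s"
    have "?s \<in> lie_terms K G \<and> lie_class K G R t = lie_class K G R ?s"
      by (rule someI[of _ t]) (simp add: t)
    then have "(?s, t) \<in> lie_cong K G R"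
      using t lie_class_eq_iff[OF cr] by metis
    from term_eval_cong[OF assms(1,2) R this] show ?thesis
      by (simp add: h_def)
  qed
  have "h \<in> lie_hom K (presented_lie K G R) L"
    by (auto simp: lie_hom_def presented_carrier presented_add[OF cr] presented_bracket[OF cr]
        presented_smult[OF cr] h cl lie_terms.intros)
  then show ?thesis
    using h by (intro bexI[of _ h] ballI)
qed

lemma presented_hom_unique:
  assumes "lie_algebra K L"
    and g: "g \<in> lie_hom K (presented_lie K G R) L" and h: "h \<in> lie_hom K (presented_lie K G R) L"
    and gen: "\<And>x. x \<in> G \<Longrightarrow> g (lie_class K G R (LGen x)) = h (lie_class K G R (LGen x))"
    and x: "x \<in> carrier (presented_lie K G R)"
  shows "g x = h x"
proof -
  interpret lie_algebra K L by fact
  have cr: "cring K" by (rule K.is_cring)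
  have P: "lie_algebra K (presented_lie K G R)"
    by (intro presented_lie_algebra K.field_axioms)
  have "g (lie_class K G R t) = h (lie_class K G R t)" if "t \<in> lie_terms K G" for t
    using that
  proof induction
    case (gen x) then show ?case by (rule assms(4))
  next
    case zero
    then show ?case
      using lie_hom_zero[OF P assms(1) g] lie_hom_zero[OF P assms(1) h]
      by (simp add: presented_zero)
  next
    case (add s t)
    then show ?case
      using lie_hom_add[OF g, of "lie_class K G R s" "lie_class K G R t"]
        lie_hom_add[OF h, of "lie_class K G R s" "lie_class K G R t"]
      by (simp add: presented_carrier presented_add[OF cr])
  next
    case (smult c t)
    then show ?case
      using lie_hom_smult[OF g, of c "lie_class K G R t"]
        lie_hom_smult[OF h, of c "lie_class K G R t"]
      by (simp add: presented_carrier presented_smult[OF cr])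
  next
    case (br s t)
    then show ?case
      using lie_hom_bracket[OF g, of "lie_class K G R s" "lie_class K G R t"]
        lie_hom_bracket[OF h, of "lie_class K G R s" "lie_class K G R t"]
      by (simp add: presented_carrier presented_bracket[OF cr])
  qed
  then show ?thesis using x by (auto simp: presented_carrier)
qed

lemma free_lie_algebra: "field K \<Longrightarrow> lie_algebra K (free_lie K X)"
  unfolding free_lie_def by (rule presented_lie_algebra)

lemma free_lie_var_closed: "x \<in> X \<Longrightarrow> free_lie_var K X x \<in> carrier (free_lie K X)"
  by (auto simp: free_lie_def free_lie_var_def presented_carrier intro: lie_terms.gen)

lemma free_lie_universal:
  assumes "lie_algebra K L" "v \<in> X \<rightarrow> carrier L"
  shows "\<exists>h\<in>lie_hom K (free_lie K X) L. \<forall>x\<in>X. h (free_lie_var K X x) = v x"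
proof -
  from presented_universal[OF assms, of "{}"] obtain h where
    "h \<in> lie_hom K (free_lie K X) L"
    "\<forall>t\<in>lie_terms K X. h (lie_class K X {} t) = term_eval L v t"
    unfolding free_lie_def by blast
  then show ?thesis
    by (intro bexI[of _ h]) (simp_all add: free_lie_var_def lie_terms.gen)
qed

lemma free_lie_hom_unique:
  assumes "lie_algebra K L" "g \<in> lie_hom K (free_lie K X) L" "h \<in> lie_hom K (free_lie K X) L"
    and "\<And>x. x \<in> X \<Longrightarrow> g (free_lie_var K X x) = h (free_lie_var K X x)"
    and "y \<in> carrier (free_lie K X)"
  shows "g y = h y"
  using assms unfolding free_lie_def free_lie_var_def by (rule presented_hom_unique)

lemma lie_free_product_algebra: "field K \<Longrightarrow> lie_algebra K (lie_free_product K L M)"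
  unfolding lie_free_product_def by (rule presented_lie_algebra)

lemma free_product_table_hom:
  assumes "lie_algebra K L" "j ` carrier L \<subseteq> G" "table_rels K L j \<subseteq> R"
  shows "(\<lambda>x. lie_class K G R (LGen (j x))) \<in> lie_hom K L (presented_lie K G R)"
proof -
  interpret lie_algebra K L by fact
  have cr: "cring K" by (rule K.is_cring)
  have [simp]: "LGen (j x) \<in> lie_terms K G" if "x \<in> carrier L" for x
    using assms(2) that by (auto intro: lie_terms.gen)
  have "(LAdd (LGen (j x)) (LGen (j y)), LGen (j (x \<oplus>\<^bsub>L\<^esub> y))) \<in> lie_cong K G R"
    "(LBr (LGen (j x)) (LGen (j y)), LGen (j (x \<otimes>\<^bsub>L\<^esub> y))) \<in> lie_cong K G R"
    if "x \<in> carrier L" "y \<in> carrier L" for x y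
    by (rule lie_cong.rel[OF subsetD[OF assms(3)]];
        use that in \<open>force simp: table_rels_def intro: lie_terms.intros(2-)\<close>)+
  moreover have "(LSmult c (LGen (j x)), LGen (j (c \<odot>\<^bsub>L\<^esub> x))) \<in> lie_cong K G R"
    if "c \<in> carrier K" "x \<in> carrier L" for c x
    by (rule lie_cong.rel[OF subsetD[OF assms(3)]];
        use that in \<open>force simp: table_rels_def intro: lie_terms.intros(2-)\<close>)
  ultimately show ?thesis
    by (auto simp: lie_hom_def presented_carrier presented_add[OF cr] presented_bracket[OF cr]
        presented_smult[OF cr] lie_class_eq_iff[OF cr] lie_terms.intros(2-) intro: lie_cong.sym)
qed

lemma free_product_inl_hom:
  assumes "lie_algebra K L"
  shows "free_product_inl K L M \<in> lie_hom K L (lie_free_product K L M)"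
  unfolding free_product_inl_def lie_free_product_def
  by (rule free_product_table_hom[OF assms])
     (auto simp: free_product_gens_def free_product_rels_def)

lemma free_product_inr_hom:
  assumes "lie_algebra K M"
  shows "free_product_inr K L M \<in> lie_hom K M (lie_free_product K L M)"
  unfolding free_product_inr_def lie_free_product_def
  by (rule free_product_table_hom[OF assms])
     (auto simp: free_product_gens_def free_product_rels_def)

lemma lie_free_product_universal:
  assumes L: "lie_algebra K L" and M: "lie_algebra K M" and N: "lie_algebra K N"
    and g: "g \<in> lie_hom K L N" and h: "h \<in> lie_hom K M N"
  shows "\<exists>u\<in>lie_hom K (lie_free_product K L M) N.
           (\<forall>x\<in>carrier L. u (free_product_inl K L M x) = g x) \<and>
           (\<forall>y\<in>carrier M. u (free_product_inr K L M y) = h y)"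
proof -
  let ?G = "free_product_gens L M" and ?R = "free_product_rels K L M"
  have v: "case_sum g h \<in> ?G \<rightarrow> carrier N"
    using g h by (auto simp: free_product_gens_def lie_hom_closed)
  have "term_eval N (case_sum g h) s = term_eval N (case_sum g h) t" if "(s, t) \<in> ?R" for s t
    using that g h
    by (auto simp: free_product_rels_def table_rels_def lie_hom_add lie_hom_smult lie_hom_bracket)
  from presented_universal[OF N v this] obtain u where
    u: "u \<in> lie_hom K (lie_free_product K L M) N"
    "\<forall>t\<in>lie_terms K ?G. u (lie_class K ?G ?R t) = term_eval N (case_sum g h) t"
    unfolding lie_free_product_def by blast
  have "LGen (Inl x) \<in> lie_terms K ?G" if "x \<in> carrier L" for x
    using that by (intro lie_terms.gen) (auto simp: free_product_gens_def)
  moreover have "LGen (Inr y) \<in> lie_terms K ?G" if "y \<in> carrier M" for y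
    using that by (intro lie_terms.gen) (auto simp: free_product_gens_def)
  ultimately show ?thesis
    using u by (intro bexI[of _ u]) (simp_all add: free_product_inl_def free_product_inr_def)
qed

lemma lie_free_product_hom_unique:
  assumes N: "lie_algebra K N"
    and "u \<in> lie_hom K (lie_free_product K L M) N" "u' \<in> lie_hom K (lie_free_product K L M) N"
    and "\<And>x. x \<in> carrier L \<Longrightarrow> u (free_product_inl K L M x) = u' (free_product_inl K L M x)"
    and "\<And>y. y \<in> carrier M \<Longrightarrow> u (free_product_inr K L M y) = u' (free_product_inr K L M y)"
    and "z \<in> carrier (lie_free_product K L M)"
  shows "u z = u' z"
proof (rule presented_hom_unique[OF N])
  show "u (lie_class K (free_product_gens L M) (free_product_rels K L M) (LGen x)) =
        u' (lie_class K (free_product_gens L M) (free_product_rels K L M) (LGen x))"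
    if "x \<in> free_product_gens L M" for x
    using that assms(4,5)
    by (auto simp: free_product_gens_def free_product_inl_def free_product_inr_def)
qed (use assms in \<open>auto simp: lie_free_product_def\<close>)


section \<open>Lie algebras over a coefficient Lie algebra\<close>

record ('k, 'a, 'b) lie_over = "('k, 'b) module" +
  emb :: "'a \<Rightarrow> 'b"

definition A_lie_algebra ::
    "('k, 'm) ring_scheme \<Rightarrow> ('k, 'a, 'n) module_scheme \<Rightarrow> ('k, 'a, 'b) lie_over \<Rightarrow> bool"
  where "A_lie_algebra K A B \<longleftrightarrow>
    lie_algebra K A \<and> lie_algebra K B \<and> emb B \<in> lie_hom K A B \<and> inj_on (emb B) (carrier A)"

definition A_hom ::
    "('k, 'm) ring_scheme \<Rightarrow> ('k, 'a, 'n) module_scheme \<Rightarrow> ('k, 'a, 'b) lie_over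
      \<Rightarrow> ('k, 'a, 'c) lie_over \<Rightarrow> ('b \<Rightarrow> 'c) set"
  where "A_hom K A B C = {h \<in> lie_hom K B C. \<forall>a\<in>carrier A. h (emb B a) = emb C a}"

definition A_iso ::
    "('k, 'm) ring_scheme \<Rightarrow> ('k, 'a, 'n) module_scheme \<Rightarrow> ('k, 'a, 'b) lie_over
      \<Rightarrow> ('k, 'a, 'c) lie_over \<Rightarrow> ('b \<Rightarrow> 'c) set"
  where "A_iso K A B C = {h \<in> A_hom K A B C. bij_betw h (carrier B) (carrier C)}"

definition A_subalgebra ::
    "('k, 'm) ring_scheme \<Rightarrow> ('k, 'a, 'n) module_scheme \<Rightarrow> ('k, 'a, 'b) lie_over \<Rightarrow> 'b set \<Rightarrow> bool"
  where "A_subalgebra K A B H \<longleftrightarrow> lie_subalgebra K B H \<and> emb B ` carrier A \<subseteq> H"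

definition A_fin_gen ::
    "('k, 'm) ring_scheme \<Rightarrow> ('k, 'a, 'n) module_scheme \<Rightarrow> ('k, 'a, 'b) lie_over \<Rightarrow> bool"
  where "A_fin_gen K A B \<longleftrightarrow>
    (\<exists>T. finite T \<and> T \<subseteq> carrier B \<and> lie_span K B (emb B ` carrier A \<union> T) = carrier B)"


section \<open>Algebraic geometry over an \<open>A\<close>-Lie algebra\<close>

type_synonym ('k, 'a) lie_poly = "('k, 'a + ('k, nat) lie_term set) lie_term set"

definition lie_poly_algebra ::
    "('k, 'm) ring_scheme \<Rightarrow> ('k, 'a, 'n) module_scheme \<Rightarrow> nat
      \<Rightarrow> ('k, 'a, ('k, 'a) lie_poly) lie_over"
  where "lie_poly_algebra K A n =
    module.extend (lie_free_product K A (free_lie K {1..n}))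
      (lie_over.fields (free_product_inl K A (free_lie K {1..n})))"

definition lie_poly_var ::
    "('k, 'm) ring_scheme \<Rightarrow> ('k, 'a, 'n) module_scheme \<Rightarrow> nat \<Rightarrow> nat \<Rightarrow> ('k, 'a) lie_poly"
  where "lie_poly_var K A n i =
    free_product_inr K A (free_lie K {1..n}) (free_lie_var K {1..n} i)"

definition points :: "nat \<Rightarrow> ('k, 'a, 'b) lie_over \<Rightarrow> (nat \<Rightarrow> 'b) set"
  where "points n B = {1..n} \<rightarrow>\<^sub>E carrier B"

text \<open>
  The value \<open>f(p)\<close>. The homomorphism chosen here exists and is uniquely determined on the
  carrier; see \<open>ex_eval_hom\<close> and \<open>eval_hom_unique\<close> below.
\<close>

definition poly_eval ::
    "('k, 'm) ring_scheme \<Rightarrow> ('k, 'a, 'n) module_scheme \<Rightarrow> nat \<Rightarrow> ('k, 'a, 'b) lie_over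
      \<Rightarrow> ('k, 'a) lie_poly \<Rightarrow> (nat \<Rightarrow> 'b) \<Rightarrow> 'b"
  where "poly_eval K A n B f p =
    (SOME h. h \<in> A_hom K A (lie_poly_algebra K A n) B \<and>
             (\<forall>i\<in>{1..n}. h (lie_poly_var K A n i) = p i)) f"

definition alg_set ::
    "('k, 'm) ring_scheme \<Rightarrow> ('k, 'a, 'n) module_scheme \<Rightarrow> nat \<Rightarrow> ('k, 'a, 'b) lie_over
      \<Rightarrow> ('k, 'a) lie_poly set \<Rightarrow> (nat \<Rightarrow> 'b) set"
  where "alg_set K A n B S = {p \<in> points n B. \<forall>f\<in>S. poly_eval K A n B f p = \<zero>\<^bsub>B\<^esub>}"

definition lie_radical ::
    "('k, 'm) ring_scheme \<Rightarrow> ('k, 'a, 'n) module_scheme \<Rightarrow> nat \<Rightarrow> ('k, 'a, 'b) lie_over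
      \<Rightarrow> ('k, 'a) lie_poly set \<Rightarrow> ('k, 'a) lie_poly set"
  where "lie_radical K A n B S =
    {f \<in> carrier (lie_poly_algebra K A n). \<forall>p\<in>alg_set K A n B S. poly_eval K A n B f p = \<zero>\<^bsub>B\<^esub>}"

definition geom_equivalent ::
    "('k, 'm) ring_scheme \<Rightarrow> ('k, 'a, 'n) module_scheme \<Rightarrow> ('k, 'a, 'b) lie_over
      \<Rightarrow> ('k, 'a, 'c) lie_over \<Rightarrow> bool"
  where "geom_equivalent K A B C \<longleftrightarrow>
    (\<forall>n\<ge>1. \<forall>S\<subseteq>carrier (lie_poly_algebra K A n). lie_radical K A n B S = lie_radical K A n C S)"

lemma lie_algebra_ops_cong:
  assumes "lie_algebra K L" "carrier M = carrier L" "zero M = zero L" "add M = add L"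
    "mult M = mult L" "smult M = smult L"
  shows "lie_algebra K M"
proof -
  interpret lie_algebra K L by fact
  have "abelian_group M"
    by (rule abelian_groupI) (auto simp: assms M.a_assoc intro: M.l_neg M.a_comm)
  then have "module K M"
    by (intro moduleI K.is_cring)
       (auto simp: assms smult_l_distr smult_r_distr smult_assoc1)
  then show ?thesis
    by (intro lie_algebra.intro lie_algebra_axioms.intro K.field_axioms)
       (auto simp: assms bracket_add_left bracket_add_right bracket_smult_left
         bracket_smult_right bracket_self jacobi)
qed

lemma lie_poly_sel [simp]:
  "carrier (lie_poly_algebra K A n) = carrier (lie_free_product K A (free_lie K {1..n}))"
  "zero (lie_poly_algebra K A n) = zero (lie_free_product K A (free_lie K {1..n}))"
  "add (lie_poly_algebra K A n) = add (lie_free_product K A (free_lie K {1..n}))"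
  "mult (lie_poly_algebra K A n) = mult (lie_free_product K A (free_lie K {1..n}))"
  "smult (lie_poly_algebra K A n) = smult (lie_free_product K A (free_lie K {1..n}))"
  "emb (lie_poly_algebra K A n) = free_product_inl K A (free_lie K {1..n})"
  by (simp_all add: lie_poly_algebra_def module.defs lie_over.defs)

lemma lie_hom_poly [simp]:
  "lie_hom K (lie_poly_algebra K A n) B = lie_hom K (lie_free_product K A (free_lie K {1..n})) B"
  "lie_hom K B (lie_poly_algebra K A n) = lie_hom K B (lie_free_product K A (free_lie K {1..n}))"
  by (simp_all add: lie_hom_def)

lemma ex_eval_hom:
  assumes "A_lie_algebra K A B" "p \<in> points n B"
  shows "\<exists>h\<in>A_hom K A (lie_poly_algebra K A n) B. \<forall>i\<in>{1..n}. h (lie_poly_var K A n i) = p i"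
proof -
  have A: "lie_algebra K A" and B: "lie_algebra K B" and e: "emb B \<in> lie_hom K A B"
    using assms(1) by (auto simp: A_lie_algebra_def)
  have F: "lie_algebra K (free_lie K {1..n})"
    using A by (intro free_lie_algebra) (simp add: lie_algebra_def)
  have "p \<in> {1..n} \<rightarrow> carrier B" using assms(2) by (auto simp: points_def PiE_def)
  from free_lie_universal[OF B this]
  obtain g where g: "g \<in> lie_hom K (free_lie K {1..n}) B"
    "\<forall>x\<in>{1..n}. g (free_lie_var K {1..n} x) = p x" by blast
  from lie_free_product_universal[OF A F B e g(1)] obtain u where
    "u \<in> lie_hom K (lie_free_product K A (free_lie K {1..n})) B"
    "\<forall>x\<in>carrier A. u (free_product_inl K A (free_lie K {1..n}) x) = emb B x"
    "\<forall>y\<in>carrier (free_lie K {1..n}). u (free_product_inr K A (free_lie K {1..n}) y) = g y"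
    by blast
  then show ?thesis
    using g(2) by (intro bexI[of _ u]) (simp_all add: A_hom_def lie_poly_var_def free_lie_var_closed)
qed

lemma eval_hom_unique:
  assumes "lie_algebra K A" "lie_algebra K B"
    and g: "g \<in> A_hom K A (lie_poly_algebra K A n) B" and h: "h \<in> A_hom K A (lie_poly_algebra K A n) B"
    and v: "\<And>i. i \<in> {1..n} \<Longrightarrow> g (lie_poly_var K A n i) = h (lie_poly_var K A n i)"
    and f: "f \<in> carrier (lie_poly_algebra K A n)"
  shows "g f = h f"
proof -
  let ?F = "free_lie K {1..n}"
  have F: "lie_algebra K ?F"
    using assms(1) by (intro free_lie_algebra) (simp add: lie_algebra_def)
  have g': "g \<in> lie_hom K (lie_free_product K A ?F) B" and h': "h \<in> lie_hom K (lie_free_product K A ?F) B"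
    using g h by (simp_all add: A_hom_def)
  note j = free_product_inr_hom[OF F, of A]
  show ?thesis
  proof (rule lie_free_product_hom_unique[OF assms(2) g' h'])
    fix x assume "x \<in> carrier A"
    then show "g (free_product_inl K A ?F x) = h (free_product_inl K A ?F x)"
      using g h by (simp add: A_hom_def)
  next
    fix y assume "y \<in> carrier ?F"
    then have "(g \<circ> free_product_inr K A ?F) y = (h \<circ> free_product_inr K A ?F) y"
      by (rule free_lie_hom_unique[OF assms(2) lie_hom_comp[OF j g'] lie_hom_comp[OF j h'], rotated])
        (use v in \<open>simp add: lie_poly_var_def\<close>)
    then show "g (free_product_inr K A ?F y) = h (free_product_inr K A ?F y)" by simp
  qed (use f in simp)
qed

lemma poly_eval_hom:
  assumes "A_lie_algebra K A B" "p \<in> points n B"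
  shows "(\<lambda>f. poly_eval K A n B f p) \<in> A_hom K A (lie_poly_algebra K A n) B"
    and "\<And>i. i \<in> {1..n} \<Longrightarrow> poly_eval K A n B (lie_poly_var K A n i) p = p i"
proof -
  have "\<exists>h. h \<in> A_hom K A (lie_poly_algebra K A n) B \<and> (\<forall>i\<in>{1..n}. h (lie_poly_var K A n i) = p i)"
    using ex_eval_hom[OF assms] by blast
  from someI_ex[OF this]
  show "(\<lambda>f. poly_eval K A n B f p) \<in> A_hom K A (lie_poly_algebra K A n) B"
    and "\<And>i. i \<in> {1..n} \<Longrightarrow> poly_eval K A n B (lie_poly_var K A n i) p = p i"
    by (auto simp: poly_eval_def)
qed

lemma lie_poly_A_lie_algebra:
  assumes A: "lie_algebra K A"
  shows "A_lie_algebra K A (lie_poly_algebra K A n)"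
proof -
  interpret lie_algebra K A by fact
  let ?F = "free_lie K {1..n}"
  have F: "lie_algebra K ?F" by (intro free_lie_algebra K.field_axioms)
  have id: "(\<lambda>x. x) \<in> lie_hom K A A" by (auto simp: lie_hom_def)
  obtain g where g: "g \<in> lie_hom K ?F A"
    using free_lie_universal[OF A, of "\<lambda>_. \<zero>\<^bsub>A\<^esub>" "{1..n}"] by fast
  from lie_free_product_universal[OF A F A id g] obtain u where
    "\<forall>x\<in>carrier A. u (free_product_inl K A ?F x) = x" by blast
  then have "inj_on (free_product_inl K A ?F) (carrier A)"
    by (intro inj_on_inverseI[where g = u]) blast
  moreover have "lie_algebra K (lie_poly_algebra K A n)"
    by (rule lie_algebra_ops_cong[OF lie_free_product_algebra[of K A ?F]])
       (simp_all add: K.field_axioms)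
  ultimately show ?thesis
    using A free_product_inl_hom[OF A, of ?F] by (simp add: A_lie_algebra_def)
qed


section \<open>Prevarieties\<close>

definition cart_prod :: "'i set \<Rightarrow> ('i \<Rightarrow> ('k, 'a, 'b) lie_over) \<Rightarrow> ('k, 'a, 'i \<Rightarrow> 'b) lie_over"
  where "cart_prod I F =
    \<lparr>carrier = (\<Pi>\<^sub>E i\<in>I. carrier (F i)),
     mult = (\<lambda>x y. \<lambda>i\<in>I. x i \<otimes>\<^bsub>F i\<^esub> y i),
     one = undefined,
     zero = (\<lambda>i\<in>I. \<zero>\<^bsub>F i\<^esub>),
     add = (\<lambda>x y. \<lambda>i\<in>I. x i \<oplus>\<^bsub>F i\<^esub> y i),
     smult = (\<lambda>c x. \<lambda>i\<in>I. c \<odot>\<^bsub>F i\<^esub> x i),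
     emb = (\<lambda>a. \<lambda>i\<in>I. emb (F i) a)\<rparr>"

definition embeds_in_prod ::
    "'i set \<Rightarrow> ('k, 'm) ring_scheme \<Rightarrow> ('k, 'a, 'n) module_scheme \<Rightarrow> ('k, 'a, 'b) lie_over set
      \<Rightarrow> ('k, 'a, 'd) lie_over \<Rightarrow> bool"
  where "embeds_in_prod I K A \<K> D \<longleftrightarrow>
    (I \<noteq> {} \<or> carrier A = {\<zero>\<^bsub>A\<^esub>}) \<and>
    (\<exists>F H h. (\<forall>i\<in>I. F i \<in> \<K>) \<and> A_subalgebra K A (cart_prod I F) H \<and>
             h \<in> A_iso K A D (cart_prod I F \<lparr>carrier := H\<rparr>))"

text \<open>
  The members of a class of Lie algebras are taken with carriers in a fixed type \<open>'u\<close>, which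
  plays the role of a universe; the index sets of the products are taken in the same type.
  The latter is no restriction: by \<open>embeds_in_prod_index\<close> below, an algebra that embeds in a
  product over any index set embeds in one indexed by a subset of its own carrier. For
  finitely generated algebras the former is no restriction either, as soon as \<open>'u\<close> is infinite
  and at least as large as \<open>K\<close> and \<open>A\<close>: by \<open>fin_gen_copy\<close> every finitely generated
  \<open>A\<close>-Lie algebra, of whatever type, then has an \<open>A\<close>-isomorphic copy with carrier in \<open>'u\<close>.
\<close>

definition A_pvar ::
    "('k, 'm) ring_scheme \<Rightarrow> ('k, 'a, 'n) module_scheme \<Rightarrow> ('k, 'a, 'b) lie_over set
      \<Rightarrow> ('k, 'a, 'u) lie_over set"
  where "A_pvar K A \<K> = {D. A_lie_algebra K A D \<and> (\<exists>I::'u set. embeds_in_prod I K A \<K> D)}"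

definition fin_gen_part ::
    "('k, 'm) ring_scheme \<Rightarrow> ('k, 'a, 'n) module_scheme \<Rightarrow> ('k, 'a, 'u) lie_over set
      \<Rightarrow> ('k, 'a, 'u) lie_over set"
  where "fin_gen_part K A \<K> = {D \<in> \<K>. A_fin_gen K A D}"


subsection \<open>Independence of the choice of the universe\<close>

lemma lie_subalgebra_carrier:
  assumes "lie_algebra K L"
  shows "lie_subalgebra K L (carrier L)"
proof -
  interpret lie_algebra K L by fact
  show ?thesis by (simp add: lie_subalgebra_def carrier_is_submodule)
qed

lemma lie_subalgebraI:
  assumes "lie_algebra K L" "H \<subseteq> carrier L" "\<zero>\<^bsub>L\<^esub> \<in> H"
    and "\<And>x y. \<lbrakk>x \<in> H; y \<in> H\<rbrakk> \<Longrightarrow> x \<oplus>\<^bsub>L\<^esub> y \<in> H"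
    and smult: "\<And>c x. \<lbrakk>c \<in> carrier K; x \<in> H\<rbrakk> \<Longrightarrow> c \<odot>\<^bsub>L\<^esub> x \<in> H"
    and "\<And>x y. \<lbrakk>x \<in> H; y \<in> H\<rbrakk> \<Longrightarrow> x \<otimes>\<^bsub>L\<^esub> y \<in> H"
  shows "lie_subalgebra K L H"
proof -
  interpret lie_algebra K L by fact
  have "\<ominus>\<^bsub>L\<^esub> x \<in> H" if "x \<in> H" for x
  proof -
    have "x \<in> carrier L" using that assms(2) by blast
    then have "\<ominus>\<^bsub>L\<^esub> x = (\<ominus>\<^bsub>K\<^esub> \<one>\<^bsub>K\<^esub>) \<odot>\<^bsub>L\<^esub> x" by (simp add: smult_l_minus)
    then show ?thesis using smult[of "\<ominus>\<^bsub>K\<^esub> \<one>\<^bsub>K\<^esub>" x] that by simp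
  qed
  then show ?thesis
    using assms(2-) by (auto simp: lie_subalgebra_def intro!: submoduleI)
qed

lemma cart_prod_lie_algebra:
  assumes "field K" "\<And>i. i \<in> I \<Longrightarrow> lie_algebra K (F i)"
  shows "lie_algebra K (cart_prod I F)"
proof -
  interpret K: field K by fact
  have M: "module K (F i)" if "i \<in> I" for i using assms(2)[OF that] by (simp add: lie_algebra_def)
  have G: "abelian_group (F i)" if "i \<in> I" for i using M[OF that] by (simp add: module_def)
  have Mo: "abelian_monoid (F i)" if "i \<in> I" for i using G[OF that] by (simp add: abelian_group_def)
  let ?P = "cart_prod I F"
  have mem: "x i \<in> carrier (F i)" if "x \<in> carrier ?P" "i \<in> I" for x i
    using that by (auto simp: cart_prod_def)
  note [simp] = abelian_monoid.a_closed[OF Mo] abelian_monoid.zero_closed[OF Mo]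
    lie_algebra.bracket_closed[OF assms(2)] module.smult_closed[OF M]
    abelian_monoid.l_zero[OF Mo]
  have ext: "x = y" if "x \<in> carrier ?P" "y \<in> carrier ?P" "\<And>i. i \<in> I \<Longrightarrow> x i = y i" for x y
    using that by (auto simp: cart_prod_def intro: PiE_ext)
  have cl: "x \<oplus>\<^bsub>?P\<^esub> y \<in> carrier ?P" "x \<otimes>\<^bsub>?P\<^esub> y \<in> carrier ?P"
    if "x \<in> carrier ?P" "y \<in> carrier ?P" for x y
    using that by (auto simp: cart_prod_def PiE_iff)
  have cl': "c \<odot>\<^bsub>?P\<^esub> x \<in> carrier ?P" if "c \<in> carrier K" "x \<in> carrier ?P" for c x
    using that by (auto simp: cart_prod_def PiE_iff)
  have z: "\<zero>\<^bsub>?P\<^esub> \<in> carrier ?P" by (auto simp: cart_prod_def)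
  have app [simp]: "(x \<oplus>\<^bsub>?P\<^esub> y) i = x i \<oplus>\<^bsub>F i\<^esub> y i" "(x \<otimes>\<^bsub>?P\<^esub> y) i = x i \<otimes>\<^bsub>F i\<^esub> y i"
    "(c \<odot>\<^bsub>?P\<^esub> x) i = c \<odot>\<^bsub>F i\<^esub> x i" "\<zero>\<^bsub>?P\<^esub> i = \<zero>\<^bsub>F i\<^esub>" if "i \<in> I" for x y c i
    using that by (simp_all add: cart_prod_def)
  note mem [simp] cl [simp] cl' [simp] z [simp]
  have ab: "abelian_group ?P"
  proof (rule abelian_groupI)
    fix x assume x: "x \<in> carrier ?P"
    have "((\<ominus>\<^bsub>K\<^esub> \<one>\<^bsub>K\<^esub>) \<odot>\<^bsub>?P\<^esub> x) \<oplus>\<^bsub>?P\<^esub> x = \<zero>\<^bsub>?P\<^esub>"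
      by (rule ext) (use x in \<open>simp_all add: module.smult_l_minus[OF M] module.smult_one[OF M]
          abelian_group.l_neg[OF G]\<close>)
    moreover have "(\<ominus>\<^bsub>K\<^esub> \<one>\<^bsub>K\<^esub>) \<odot>\<^bsub>?P\<^esub> x \<in> carrier ?P" using x by simp
    ultimately show "\<exists>y\<in>carrier ?P. y \<oplus>\<^bsub>?P\<^esub> x = \<zero>\<^bsub>?P\<^esub>" by blast
  next
    fix x y z assume "x \<in> carrier ?P" "y \<in> carrier ?P" "z \<in> carrier ?P"
    then show "x \<oplus>\<^bsub>?P\<^esub> y \<oplus>\<^bsub>?P\<^esub> z = x \<oplus>\<^bsub>?P\<^esub> (y \<oplus>\<^bsub>?P\<^esub> z)"
      by (intro ext) (simp_all add: abelian_monoid.a_assoc[OF Mo])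
  next
    fix x y assume "x \<in> carrier ?P" "y \<in> carrier ?P"
    then show "x \<oplus>\<^bsub>?P\<^esub> y = y \<oplus>\<^bsub>?P\<^esub> x"
      by (intro ext) (simp_all add: abelian_monoid.a_comm[OF Mo])
  next
    fix x assume "x \<in> carrier ?P"
    then show "\<zero>\<^bsub>?P\<^esub> \<oplus>\<^bsub>?P\<^esub> x = x" by (intro ext) simp_all
  qed simp_all
  have "module K ?P"
    by (rule moduleI[OF K.is_cring ab])
       (simp, (rule ext; simp add: module.smult_l_distr[OF M] module.smult_r_distr[OF M]
          module.smult_assoc1[OF M] module.smult_one[OF M])+)
  then show ?thesis
    by (intro lie_algebra.intro lie_algebra_axioms.intro assms(1))
       (assumption, simp, (rule ext; simp add: lie_algebra.bracket_add_left[OF assms(2)]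
          lie_algebra.bracket_add_right[OF assms(2)] lie_algebra.bracket_smult_left[OF assms(2)]
          lie_algebra.bracket_smult_right[OF assms(2)] lie_algebra.bracket_self[OF assms(2)]
          lie_algebra.jacobi[OF assms(2)])+)
qed

lemma embeds_in_prod_iff:
  assumes D: "A_lie_algebra K A D" and \<K>: "\<forall>B\<in>\<K>. A_lie_algebra K A B"
  shows "embeds_in_prod I K A \<K> D \<longleftrightarrow>
    (I \<noteq> {} \<or> carrier A = {\<zero>\<^bsub>A\<^esub>}) \<and>
    (\<exists>F g. (\<forall>i\<in>I. F i \<in> \<K> \<and> g i \<in> A_hom K A D (F i)) \<and>
           (\<forall>x\<in>carrier D. \<forall>y\<in>carrier D. (\<forall>i\<in>I. g i x = g i y) \<longrightarrow> x = y))"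
    (is "_ \<longleftrightarrow> ?I \<and> ?R")
proof (intro iffI conjI)
  assume E: "embeds_in_prod I K A \<K> D"
  then show ?I by (simp add: embeds_in_prod_def)
  from E obtain F H h where F: "\<forall>i\<in>I. F i \<in> \<K>" and H: "A_subalgebra K A (cart_prod I F) H"
    and h: "h \<in> A_iso K A D (cart_prod I F \<lparr>carrier := H\<rparr>)"
    by (auto simp: embeds_in_prod_def)
  have "lie_algebra K (cart_prod I F)"
    using D \<K> F by (intro cart_prod_lie_algebra) (auto simp: A_lie_algebra_def lie_algebra_def)
  then interpret P: lie_algebra K "cart_prod I F" .
  have "H \<subseteq> carrier (cart_prod I F)"
    using H P.submoduleE(1) by (auto simp: A_subalgebra_def lie_subalgebra_def)
  moreover have "h x \<in> H" if "x \<in> carrier D" for x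
    using h that by (auto simp: A_iso_def A_hom_def lie_hom_def)
  ultimately have mem: "h x \<in> (\<Pi>\<^sub>E i\<in>I. carrier (F i))" if "x \<in> carrier D" for x
    using that by (auto simp: cart_prod_def)
  have "(\<lambda>x. h x i) \<in> A_hom K A D (F i)" if "i \<in> I" for i
    using h that PiE_mem[OF mem that]
    by (auto simp: A_iso_def A_hom_def lie_hom_def cart_prod_def)
  moreover have "x = y" if "x \<in> carrier D" "y \<in> carrier D" "\<forall>i\<in>I. h x i = h y i" for x y
  proof -
    have "h x = h y" using mem that by (intro PiE_ext[of "h x" I _ "h y"]) auto
    then show ?thesis using h that by (auto simp: A_iso_def bij_betw_def dest: inj_onD)
  qed
  ultimately show ?R using F by (intro exI[of _ F] exI[of _ "\<lambda>i x. h x i"]) blast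
next
  assume "?I \<and> ?R"
  then obtain F g where I: ?I and F: "\<And>i. i \<in> I \<Longrightarrow> F i \<in> \<K>"
    and g: "\<And>i. i \<in> I \<Longrightarrow> g i \<in> A_hom K A D (F i)"
    and sep: "\<And>x y. \<lbrakk>x \<in> carrier D; y \<in> carrier D; \<forall>i\<in>I. g i x = g i y\<rbrakk> \<Longrightarrow> x = y"
    by blast
  have Dl: "lie_algebra K D" and eD: "emb D \<in> lie_hom K A D" using D by (auto simp: A_lie_algebra_def)
  interpret D: lie_algebra K D by fact
  let ?P = "cart_prod I F"
  have P: "lie_algebra K ?P"
    using D \<K> F by (intro cart_prod_lie_algebra) (auto simp: A_lie_algebra_def lie_algebra_def)
  define h where "h x = (\<lambda>i\<in>I. g i x)" for x
  have g': "g i \<in> lie_hom K D (F i)" "\<forall>a\<in>carrier A. g i (emb D a) = emb (F i) a" if "i \<in> I" for i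
    using g[OF that] by (auto simp: A_hom_def)
  have h: "h \<in> A_hom K A D ?P"
    using g' unfolding A_hom_def lie_hom_def cart_prod_def h_def
    by (auto simp: Pi_iff intro!: restrict_ext)
  then have hl: "h \<in> lie_hom K D ?P" and he: "\<And>a. a \<in> carrier A \<Longrightarrow> h (emb D a) = emb ?P a"
    by (auto simp: A_hom_def)
  have inj: "inj_on h (carrier D)"
  proof (rule inj_onI)
    fix x y assume xy: "x \<in> carrier D" "y \<in> carrier D" "h x = h y"
    have "g i x = g i y" if "i \<in> I" for i
      using fun_cong[OF xy(3), of i] that by (simp add: h_def)
    then show "x = y" using sep xy by blast
  qed
  let ?H = "h ` carrier D"
  have "lie_subalgebra K ?P ?H"
  proof (rule lie_subalgebraI[OF P])
    show "?H \<subseteq> carrier ?P" using hl by (auto simp: lie_hom_def)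
    show "\<zero>\<^bsub>?P\<^esub> \<in> ?H" using lie_hom_zero[OF Dl P hl] by (metis D.M.zero_closed imageI)
  qed (auto simp: lie_hom_add[OF hl, symmetric] lie_hom_smult[OF hl, symmetric]
      lie_hom_bracket[OF hl, symmetric])
  moreover have "emb ?P ` carrier A \<subseteq> ?H"
    using he lie_hom_closed[OF eD] by (metis image_subsetI imageI)
  ultimately have "A_subalgebra K A ?P ?H" by (simp add: A_subalgebra_def)
  moreover have "h \<in> A_iso K A D (?P \<lparr>carrier := ?H\<rparr>)"
    using h inj by (auto simp: A_iso_def A_hom_def lie_hom_def bij_betw_def)
  ultimately show "embeds_in_prod I K A \<K> D"
    using I F unfolding embeds_in_prod_def by blast
qed

lemma embeds_in_prod_index:
  fixes I :: "'i set"
  assumes D: "A_lie_algebra K A D" and \<K>: "\<forall>B\<in>\<K>. A_lie_algebra K A B"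
    and E: "embeds_in_prod I K A \<K> D"
  shows "\<exists>J\<subseteq>carrier D. embeds_in_prod J K A \<K> D"
proof -
  have Dl: "lie_algebra K D" and eD: "emb D \<in> lie_hom K A D" and Al: "lie_algebra K A"
    and eI: "inj_on (emb D) (carrier A)"
    using D by (auto simp: A_lie_algebra_def)
  interpret D: lie_algebra K D by fact
  interpret A: lie_algebra K A by fact
  obtain F g where F: "\<And>i. i \<in> I \<Longrightarrow> F i \<in> \<K>"
    and g: "\<And>i. i \<in> I \<Longrightarrow> g i \<in> A_hom K A D (F i)"
    and sep: "\<And>x y. \<lbrakk>x \<in> carrier D; y \<in> carrier D; \<forall>i\<in>I. g i x = g i y\<rbrakk> \<Longrightarrow> x = y"
    using E unfolding embeds_in_prod_iff[OF D \<K>] by blast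
  let ?J = "carrier D - {\<zero>\<^bsub>D\<^esub>}"
  have "\<exists>i\<in>I. g i x \<noteq> g i \<zero>\<^bsub>D\<^esub>" if "x \<in> ?J" for x
    using sep[of x "\<zero>\<^bsub>D\<^esub>"] that by auto
  then obtain j where j: "\<And>x. x \<in> ?J \<Longrightarrow> j x \<in> I \<and> g (j x) x \<noteq> g (j x) \<zero>\<^bsub>D\<^esub>" by metis
  have sep': "x = y" if xy: "x \<in> carrier D" "y \<in> carrier D" "\<forall>d\<in>?J. g (j d) x = g (j d) y" for x y
  proof (rule ccontr)
    assume "x \<noteq> y"
    let ?m = "(\<ominus>\<^bsub>K\<^esub> \<one>\<^bsub>K\<^esub>) \<odot>\<^bsub>D\<^esub> y"
    have m: "?m = \<ominus>\<^bsub>D\<^esub> y" using xy by (simp add: D.smult_l_minus)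
    then have mc: "?m \<in> carrier D" using xy by simp
    have d: "x \<oplus>\<^bsub>D\<^esub> ?m \<in> ?J"
      using xy \<open>x \<noteq> y\<close> mc unfolding m
      by (metis D.M.add.inv_solve_right' D.M.l_zero D.M.zero_closed DiffI D.M.add.m_closed singletonD)
    let ?h = "g (j (x \<oplus>\<^bsub>D\<^esub> ?m))"
    have h: "?h \<in> lie_hom K D (F (j (x \<oplus>\<^bsub>D\<^esub> ?m)))" using g j[OF d] by (auto simp: A_hom_def)
    have "?h (x \<oplus>\<^bsub>D\<^esub> ?m) = ?h (y \<oplus>\<^bsub>D\<^esub> ?m)"
      using xy(3) d by (simp add: lie_hom_add[OF h xy(1) mc] lie_hom_add[OF h xy(2) mc])
    also have "y \<oplus>\<^bsub>D\<^esub> ?m = \<zero>\<^bsub>D\<^esub>" using xy unfolding m by (simp add: D.M.r_neg)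
    finally show False using j[OF d] by blast
  qed
  have "?J \<noteq> {} \<or> carrier A = {\<zero>\<^bsub>A\<^esub>}"
  proof (rule disjCI)
    assume ne: "carrier A \<noteq> {\<zero>\<^bsub>A\<^esub>}"
    then obtain a where a: "a \<in> carrier A" "a \<noteq> \<zero>\<^bsub>A\<^esub>" using A.M.zero_closed by blast
    then have "emb D a \<noteq> \<zero>\<^bsub>D\<^esub>"
      using inj_onD[OF eI, of a "\<zero>\<^bsub>A\<^esub>"] lie_hom_zero[OF Al Dl eD] by auto
    then show "?J \<noteq> {}" using lie_hom_closed[OF eD a(1)] by blast
  qed
  then have "embeds_in_prod ?J K A \<K> D"
    unfolding embeds_in_prod_iff[OF D \<K>]
    using F g j sep' by (intro conjI exI[of _ "F \<circ> j"] exI[of _ "g \<circ> j"]) auto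
  then show ?thesis by blast
qed

definition transport_lie ::
    "('k, 'm) ring_scheme \<Rightarrow> ('b \<Rightarrow> 'c) \<Rightarrow> ('k, 'a, 'b) lie_over \<Rightarrow> ('k, 'a, 'c) lie_over"
  where "transport_lie K f D =
    (let g = the_inv_into (carrier D) f in
      \<lparr>carrier = f ` carrier D,
       mult = (\<lambda>x y. f (g x \<otimes>\<^bsub>D\<^esub> g y)),
       one = undefined,
       zero = f \<zero>\<^bsub>D\<^esub>,
       add = (\<lambda>x y. f (g x \<oplus>\<^bsub>D\<^esub> g y)),
       smult = (\<lambda>c x. f (c \<odot>\<^bsub>D\<^esub> g x)),
       emb = (\<lambda>a. f (emb D a))\<rparr>)"

lemma transport_lie_iso:
  assumes D: "A_lie_algebra K A D" and f: "inj_on f (carrier D)"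
  shows "A_lie_algebra K A (transport_lie K f D)" and "f \<in> A_iso K A D (transport_lie K f D)"
proof -
  have Dl: "lie_algebra K D" and eD: "emb D \<in> lie_hom K A D" and eI: "inj_on (emb D) (carrier A)"
    and Al: "lie_algebra K A"
    using D by (auto simp: A_lie_algebra_def)
  interpret D: lie_algebra K D by fact
  let ?T = "transport_lie K f D"
  have ops: "carrier ?T = f ` carrier D" "zero ?T = f \<zero>\<^bsub>D\<^esub>" "\<And>a. emb ?T a = f (emb D a)"
    "\<And>x y. \<lbrakk>x \<in> carrier D; y \<in> carrier D\<rbrakk> \<Longrightarrow> f x \<otimes>\<^bsub>?T\<^esub> f y = f (x \<otimes>\<^bsub>D\<^esub> y)"
    "\<And>x y. \<lbrakk>x \<in> carrier D; y \<in> carrier D\<rbrakk> \<Longrightarrow> f x \<oplus>\<^bsub>?T\<^esub> f y = f (x \<oplus>\<^bsub>D\<^esub> y)"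
    "\<And>c x. \<lbrakk>x \<in> carrier D\<rbrakk> \<Longrightarrow> c \<odot>\<^bsub>?T\<^esub> f x = f (c \<odot>\<^bsub>D\<^esub> x)"
    by (simp_all add: transport_lie_def Let_def the_inv_into_f_f[OF f])
  have ab: "abelian_group ?T"
  proof (rule abelian_groupI)
    fix x assume "x \<in> carrier ?T"
    then obtain d where d: "d \<in> carrier D" "x = f d" by (auto simp: ops)
    then have "f (\<ominus>\<^bsub>D\<^esub> d) \<oplus>\<^bsub>?T\<^esub> x = \<zero>\<^bsub>?T\<^esub>" by (simp add: ops D.M.l_neg)
    moreover have "f (\<ominus>\<^bsub>D\<^esub> d) \<in> carrier ?T" using d by (simp add: ops)
    ultimately show "\<exists>y\<in>carrier ?T. y \<oplus>\<^bsub>?T\<^esub> x = \<zero>\<^bsub>?T\<^esub>" by blast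
  next
    fix x y assume "x \<in> carrier ?T" "y \<in> carrier ?T"
    then show "x \<oplus>\<^bsub>?T\<^esub> y = y \<oplus>\<^bsub>?T\<^esub> x" by (auto simp: ops D.M.a_comm)
  qed (auto simp: ops D.M.a_assoc)
  have "module K ?T"
    by (rule moduleI[OF D.K.is_cring ab])
       (auto simp: ops D.smult_l_distr D.smult_r_distr D.smult_assoc1)
  then have "lie_algebra K ?T"
    by (intro lie_algebra.intro lie_algebra_axioms.intro D.K.field_axioms)
       (auto simp: ops D.bracket_add_left D.bracket_add_right D.bracket_smult_left
         D.bracket_smult_right D.bracket_self D.jacobi)
  moreover have "emb ?T \<in> lie_hom K A ?T"
    using lie_hom_closed[OF eD]
    by (auto simp: lie_hom_def ops lie_hom_add[OF eD] lie_hom_smult[OF eD] lie_hom_bracket[OF eD])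
  moreover have "inj_on (emb ?T) (carrier A)"
    using lie_hom_closed[OF eD] by (auto simp: inj_on_def ops dest!: inj_onD[OF f] inj_onD[OF eI])
  ultimately show "A_lie_algebra K A ?T" using Al by (simp add: A_lie_algebra_def)
  show "f \<in> A_iso K A D ?T"
    using f by (auto simp: A_iso_def A_hom_def lie_hom_def ops bij_betw_def)
qed

lemma lepoll_UNIV_Un:
  assumes "infinite (UNIV :: 'u set)" "S \<lesssim> (UNIV :: 'u set)" "T \<lesssim> (UNIV :: 'u set)"
  shows "S \<union> T \<lesssim> (UNIV :: 'u set)"
  using assms unfolding lepoll_def card_of_ordLeq
  by (intro card_of_Un_ordLeq_infinite_Field) (simp_all add: Field_card_of card_of_card_order_on)

lemma lepoll_UNIV_image_Times:
  assumes "infinite (UNIV :: 'u set)" "S \<lesssim> (UNIV :: 'u set)" "T \<lesssim> (UNIV :: 'u set)"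
  shows "f ` (S \<times> T) \<lesssim> (UNIV :: 'u set)"
proof -
  have "S \<times> T \<lesssim> (UNIV :: 'u set)"
    using assms unfolding lepoll_def card_of_ordLeq
    by (intro card_of_Times_ordLeq_infinite_Field) (simp_all add: Field_card_of card_of_card_order_on)
  then show ?thesis using image_lepoll lepoll_trans by blast
qed

lemma lie_span_lepoll:
  assumes L: "lie_algebra K L" and T: "T \<subseteq> carrier L" and inf: "infinite (UNIV :: 'u set)"
    and K: "carrier K \<lesssim> (UNIV :: 'u set)" and Tu: "T \<lesssim> (UNIV :: 'u set)"
  shows "lie_span K L T \<lesssim> (UNIV :: 'u set)"
proof -
  interpret lie_algebra K L by fact
  define step where "step S = S \<union> (\<lambda>(x, y). x \<oplus>\<^bsub>L\<^esub> y) ` (S \<times> S) \<union>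
    (\<lambda>(x, y). x \<otimes>\<^bsub>L\<^esub> y) ` (S \<times> S) \<union> (\<lambda>(c, x). c \<odot>\<^bsub>L\<^esub> x) ` (carrier K \<times> S)" for S
  define S where "S m = (step ^^ m) (insert \<zero>\<^bsub>L\<^esub> T)" for m
  have S0: "S 0 = insert \<zero>\<^bsub>L\<^esub> T" and SS: "S (Suc m) = step (S m)" for m
    by (simp_all add: S_def)
  have sub: "S m \<subseteq> carrier L" for m
  proof (induction m)
    case 0 then show ?case using T by (simp add: S0)
  next
    case (Suc m) then show ?case by (auto simp: SS step_def)
  qed
  have mono: "S m \<subseteq> S n" if "m \<le> n" for m n
    using that by (rule lift_Suc_mono_le[rotated]) (auto simp: SS step_def)
  have two: "\<exists>m. x \<in> S m \<and> y \<in> S m" if xy: "x \<in> (\<Union>m. S m)" "y \<in> (\<Union>m. S m)" for x y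
  proof -
    obtain a b where "x \<in> S a" "y \<in> S b" using xy by blast
    then have "x \<in> S (max a b)" "y \<in> S (max a b)"
      using mono[of a "max a b"] mono[of b "max a b"] by auto
    then show ?thesis by blast
  qed
  have "lie_subalgebra K L (\<Union>m. S m)"
  proof (rule lie_subalgebraI[OF L])
    show "(\<Union>m. S m) \<subseteq> carrier L" using sub by blast
    have "\<zero>\<^bsub>L\<^esub> \<in> S 0" by (simp add: S0)
    then show "\<zero>\<^bsub>L\<^esub> \<in> (\<Union>m. S m)" by blast
  next
    fix x y assume "x \<in> (\<Union>m. S m)" "y \<in> (\<Union>m. S m)"
    from two[OF this] obtain m where "x \<in> S m" "y \<in> S m" by blast
    then have "x \<oplus>\<^bsub>L\<^esub> y \<in> S (Suc m) \<and> x \<otimes>\<^bsub>L\<^esub> y \<in> S (Suc m)"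
      by (force simp: SS step_def)
    then show "x \<oplus>\<^bsub>L\<^esub> y \<in> (\<Union>m. S m)" "x \<otimes>\<^bsub>L\<^esub> y \<in> (\<Union>m. S m)" by blast+
  next
    fix c x assume "c \<in> carrier K" "x \<in> (\<Union>m. S m)"
    then obtain m where "c \<in> carrier K" "x \<in> S m" by blast
    then have "c \<odot>\<^bsub>L\<^esub> x \<in> S (Suc m)" by (force simp: SS step_def)
    then show "c \<odot>\<^bsub>L\<^esub> x \<in> (\<Union>m. S m)" by blast
  qed
  moreover have "T \<subseteq> (\<Union>m. S m)" using S0 by blast
  ultimately have le: "lie_span K L T \<subseteq> (\<Union>m. S m)" by (auto simp: lie_span_def)
  have "S m \<lesssim> (UNIV :: 'u set)" for m
  proof (induction m)
    case 0
    have "insert \<zero>\<^bsub>L\<^esub> T = {\<zero>\<^bsub>L\<^esub>} \<union> T" by simp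
    also have "\<dots> \<lesssim> (UNIV :: 'u set)"
      by (intro lepoll_UNIV_Un[OF inf _ Tu] finite_lepoll_infinite[OF inf]) simp
    finally show ?case by (simp add: S0)
  next
    case (Suc m)
    then show ?case
      unfolding SS step_def
      by (intro lepoll_UNIV_Un[OF inf] lepoll_UNIV_image_Times[OF inf] K)
  qed
  moreover have "(UNIV :: nat set) \<lesssim> (UNIV :: 'u set)" using inf by (simp add: infinite_le_lepoll)
  ultimately have "(\<Union>m. S m) \<lesssim> (UNIV :: 'u set)"
    using inf unfolding lepoll_def card_of_ordLeq by (intro card_of_UNION_ordLeq_infinite) auto
  then show ?thesis using le subset_imp_lepoll lepoll_trans by blast
qed

lemma fin_gen_copy:
  assumes D: "A_lie_algebra K A D" "A_fin_gen K A D" and inf: "infinite (UNIV :: 'u set)"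
    and K: "carrier K \<lesssim> (UNIV :: 'u set)" and A: "carrier A \<lesssim> (UNIV :: 'u set)"
  shows "\<exists>D' :: ('k, 'a, 'u) lie_over. A_lie_algebra K A D' \<and> A_iso K A D D' \<noteq> {}"
proof -
  have Dl: "lie_algebra K D" and eD: "emb D \<in> lie_hom K A D" using D by (auto simp: A_lie_algebra_def)
  obtain T where T: "finite T" "T \<subseteq> carrier D" "lie_span K D (emb D ` carrier A \<union> T) = carrier D"
    using D(2) by (auto simp: A_fin_gen_def)
  have "emb D ` carrier A \<lesssim> (UNIV :: 'u set)" using A image_lepoll lepoll_trans by blast
  then have "emb D ` carrier A \<union> T \<lesssim> (UNIV :: 'u set)"
    using finite_lepoll_infinite[OF inf T(1)] by (rule lepoll_UNIV_Un[OF inf])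
  from lie_span_lepoll[OF Dl _ inf K this] have "carrier D \<lesssim> (UNIV :: 'u set)"
    using T lie_hom_closed[OF eD] by auto
  then obtain f :: "_ \<Rightarrow> 'u" where "inj_on f (carrier D)" by (auto simp: lepoll_def)
  from transport_lie_iso[OF D(1) this] show ?thesis by blast
qed

end

theory Submission
  imports Defs
begin

text \<open>
  A finitely generated \<open>A\<close>-Lie algebra is the image \<open>D\<close> of some \<open>A[x_1, \<dots>, x_n]\<close> under
  evaluation at a point. Points of \<open>B\<close> annihilated by the kernel \<open>S\<close> of that evaluation
  correspond to \<open>A\<close>-homomorphisms from \<open>D\<close> to \<open>B\<close>, so \<open>D\<close> embeds in a power of \<open>B\<close> if and
  only if \<open>Rad_B(S) = S\<close>. Conversely, every radical over \<open>C\<close> of a set with a zero in \<open>C\<close> is such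
  a kernel. Thus an inclusion between the finitely generated parts of the two prevarieties
  amounts to the reverse inclusion between the radicals: if \<open>Rad_C(S)\<close> is closed under
  \<open>Rad_B\<close>, then \<open>Rad_B(S)\<close> is contained in it.
\<close>

section \<open>Homomorphisms and evaluation at points\<close>

lemma A_lie_algebraD:
  assumes "A_lie_algebra K A B"
  shows "lie_algebra K A" "lie_algebra K B" "emb B \<in> lie_hom K A B" "inj_on (emb B) (carrier A)"
  using assms by (simp_all add: A_lie_algebra_def)

lemma A_homD:
  assumes "h \<in> A_hom K A B C"
  shows "h \<in> lie_hom K B C" "\<And>a. a \<in> carrier A \<Longrightarrow> h (emb B a) = emb C a"
  using assms by (simp_all add: A_hom_def)

lemma A_hom_comp:
  assumes "g \<in> A_hom K A B C" "h \<in> A_hom K A C D"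
  shows "h \<circ> g \<in> A_hom K A B D"
  using assms by (auto simp: A_hom_def intro: lie_hom_comp)

lemma poly_eval_closed:
  assumes "A_lie_algebra K A B" "p \<in> points n B" "f \<in> carrier (lie_poly_algebra K A n)"
  shows "poly_eval K A n B f p \<in> carrier B"
  using lie_hom_closed[OF A_homD(1)[OF poly_eval_hom(1)[OF assms(1,2)]] assms(3)] .

lemma lie_poly_var_closed:
  assumes "lie_algebra K A" "i \<in> {1..n}"
  shows "lie_poly_var K A n i \<in> carrier (lie_poly_algebra K A n)"
proof -
  have "lie_algebra K (free_lie K {1..n})"
    using assms(1) by (intro free_lie_algebra) (simp add: lie_algebra_def)
  from lie_hom_closed[OF free_product_inr_hom[OF this, of A] free_lie_var_closed[OF assms(2), of K]]
  show ?thesis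
    by (simp add: lie_poly_var_def)
qed

lemma points_map:
  assumes "p \<in> points n B" "h \<in> lie_hom K B C"
  shows "(\<lambda>i\<in>{1..n}. h (p i)) \<in> points n C"
  using lie_hom_closed[OF assms(2)] PiE_mem[OF assms(1)[unfolded points_def]]
  by (simp add: points_def)

text \<open>As functions of \<open>f\<close>, both sides are \<open>A\<close>-homomorphisms from
  \<open>A[X]\<close> to \<open>C\<close> that agree on the variables, so
  \<open>eval_hom_unique\<close> identifies them. The restriction to \<open>{1..n}\<close> appears
  because \<open>points\<close> consists of extensional functions.\<close>

lemma poly_eval_map:
  assumes B: "A_lie_algebra K A B" and C: "A_lie_algebra K A C"
    and p: "p \<in> points n B" and h: "h \<in> A_hom K A B C"
    and f: "f \<in> carrier (lie_poly_algebra K A n)"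
  shows "poly_eval K A n C f (\<lambda>i\<in>{1..n}. h (p i)) = h (poly_eval K A n B f p)"
proof -
  note q = points_map[OF p A_homD(1)[OF h]]
  have "(h \<circ> (\<lambda>f. poly_eval K A n B f p)) f = poly_eval K A n C f (\<lambda>i\<in>{1..n}. h (p i))"
    by (rule eval_hom_unique[OF A_lie_algebraD(1,2)[OF C] A_hom_comp[OF poly_eval_hom(1)[OF B p] h]
          poly_eval_hom(1)[OF C q] _ f])
       (use poly_eval_hom(2)[OF B p] poly_eval_hom(2)[OF C q] in auto)
  then show ?thesis by simp
qed

section \<open>Subalgebras and images of \<open>A\<close>-homomorphisms\<close>

lemma lie_subalgebra_lie_algebra:
  assumes "lie_algebra K L" "lie_subalgebra K L H"
  shows "lie_algebra K (L\<lparr>carrier := H\<rparr>)"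
proof -
  interpret lie_algebra K L by fact
  have H: "submodule H K L" and br: "\<And>x y. \<lbrakk>x \<in> H; y \<in> H\<rbrakk> \<Longrightarrow> x \<otimes>\<^bsub>L\<^esub> y \<in> H"
    using assms(2) by (auto simp: lie_subalgebra_def)
  have sub: "\<And>x. x \<in> H \<Longrightarrow> x \<in> carrier L" using submoduleE(1)[OF H] by blast
  have "module K (L\<lparr>carrier := H\<rparr>)"
    using submodule.submodule_is_module[OF H L.module_axioms] by simp
  then show ?thesis
    by (intro lie_algebra.intro lie_algebra_axioms.intro K.field_axioms)
       (simp_all add: br sub bracket_add_left bracket_add_right bracket_smult_left
         bracket_smult_right bracket_self jacobi)
qed

lemma A_subalgebra_A_lie_algebra:
  assumes B: "A_lie_algebra K A B" and H: "A_subalgebra K A B H"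
  shows "A_lie_algebra K A (B\<lparr>carrier := H\<rparr>)"
    and "(\<lambda>x. x) \<in> A_hom K A (B\<lparr>carrier := H\<rparr>) B" and "H \<subseteq> carrier B"
proof -
  note Bs = A_lie_algebraD[OF B]
  interpret lie_algebra K B by (rule Bs)
  have sub: "lie_subalgebra K B H" and e: "emb B ` carrier A \<subseteq> H"
    using H by (auto simp: A_subalgebra_def)
  show H': "H \<subseteq> carrier B" using sub submoduleE(1) by (auto simp: lie_subalgebra_def)
  show "A_lie_algebra K A (B\<lparr>carrier := H\<rparr>)"
    using Bs lie_subalgebra_lie_algebra[OF Bs(2) sub] e
    by (auto simp: A_lie_algebra_def lie_hom_def)
  show "(\<lambda>x. x) \<in> A_hom K A (B\<lparr>carrier := H\<rparr>) B"
    using H' by (auto simp: A_hom_def lie_hom_def)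
qed

lemma A_hom_image_A_subalgebra:
  assumes B: "A_lie_algebra K A B" and C: "A_lie_algebra K A C" and h: "h \<in> A_hom K A B C"
  shows "A_subalgebra K A C (h ` carrier B)"
proof -
  note Bs = A_lie_algebraD[OF B] and Cs = A_lie_algebraD[OF C] and hl = A_homD(1)[OF h]
  interpret B: lie_algebra K B by (rule Bs)
  have "lie_subalgebra K C (h ` carrier B)"
  proof (rule lie_subalgebraI[OF Cs(2)])
    show "h ` carrier B \<subseteq> carrier C" using lie_hom_closed[OF hl] by blast
    show "\<zero>\<^bsub>C\<^esub> \<in> h ` carrier B"
      using lie_hom_zero[OF Bs(2) Cs(2) hl] by (metis B.M.zero_closed imageI)
  qed (auto simp: lie_hom_add[OF hl, symmetric] lie_hom_smult[OF hl, symmetric]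
      lie_hom_bracket[OF hl, symmetric])
  moreover have "emb C ` carrier A \<subseteq> h ` carrier B"
    using A_homD(2)[OF h] lie_hom_closed[OF Bs(3)] by (metis image_subsetI imageI)
  ultimately show ?thesis by (simp add: A_subalgebra_def)
qed

section \<open>Finite generation and coordinate algebras\<close>

text \<open>Stands for the quotient of \<open>A[X]\<close> by the kernel of evaluation at
  \<open>p\<close>. Taking the image inside \<open>B\<close> avoids quotients by ideals.\<close>

definition coord_alg ::
    "('k, 'm) ring_scheme \<Rightarrow> ('k, 'a, 'n) module_scheme \<Rightarrow> nat \<Rightarrow> ('k, 'a, 'b) lie_over
      \<Rightarrow> (nat \<Rightarrow> 'b) \<Rightarrow> 'b set"
  where "coord_alg K A n B p = (\<lambda>f. poly_eval K A n B f p) ` carrier (lie_poly_algebra K A n)"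

text \<open>The image of evaluation is an \<open>A\<close>-subalgebra containing the coordinates of
  \<open>p\<close>. Conversely, if a subalgebra \<open>H\<close> contains \<open>A\<close> and these
  coordinates, then \<open>p\<close> is a point of \<open>H\<close>, and evaluation in
  \<open>H\<close> gives the same values as evaluation in \<open>B\<close>.\<close>

lemma coord_alg_eq_lie_span:
  assumes B: "A_lie_algebra K A B" and p: "p \<in> points n B"
  shows "coord_alg K A n B p = lie_span K B (emb B ` carrier A \<union> p ` {1..n})" (is "?L = ?R")
proof
  note P = lie_poly_A_lie_algebra[OF A_lie_algebraD(1)[OF B], of n]
  show "?R \<subseteq> ?L"
  proof -
    have sub: "A_subalgebra K A B ?L"
      unfolding coord_alg_def by (rule A_hom_image_A_subalgebra[OF P B poly_eval_hom(1)[OF B p]])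
    have "p i \<in> ?L" if "i \<in> {1..n}" for i
      using imageI[OF lie_poly_var_closed[OF A_lie_algebraD(1)[OF B] that],
          of "\<lambda>f. poly_eval K A n B f p"]
      unfolding coord_alg_def poly_eval_hom(2)[OF B p that] .
    then show ?thesis using sub by (auto simp: lie_span_def A_subalgebra_def)
  qed
  have "poly_eval K A n B f p \<in> H"
    if f: "f \<in> carrier (lie_poly_algebra K A n)"
      and H: "lie_subalgebra K B H" "emb B ` carrier A \<union> p ` {1..n} \<subseteq> H" for f H
  proof -
    let ?H = "B\<lparr>carrier := H\<rparr>"
    have sub: "A_subalgebra K A B H" using H by (simp add: A_subalgebra_def)
    note HB = A_subalgebra_A_lie_algebra[OF B sub]
    have q: "p \<in> points n ?H" using p H by (auto simp: points_def PiE_iff)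
    \<comment> \<open>Naturality for the inclusion of \<open>H\<close> yields the restriction of
      \<open>p\<close>, which is \<open>p\<close> itself by extensionality.\<close>
    have "(\<lambda>i\<in>{1..n}. p i) = p" using p by (simp add: points_def PiE_iff extensional_restrict)
    then have "poly_eval K A n B f p = poly_eval K A n ?H f p"
      using poly_eval_map[OF HB(1) B q HB(2) f] by simp
    also have "\<dots> \<in> H" using poly_eval_closed[OF HB(1) q f] by simp
    finally show ?thesis .
  qed
  then show "?L \<subseteq> ?R" by (auto simp: lie_span_def coord_alg_def)
qed

lemma A_fin_gen_iff_coord_alg:
  assumes B: "A_lie_algebra K A B"
  shows "A_fin_gen K A B \<longleftrightarrow> (\<exists>n\<ge>1. \<exists>p\<in>points n B. coord_alg K A n B p = carrier B)"
proof
  interpret lie_algebra K B by (rule A_lie_algebraD(2)[OF B])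
  assume "A_fin_gen K A B"
  then obtain T where T: "finite T" "T \<subseteq> carrier B"
    "lie_span K B (emb B ` carrier A \<union> T) = carrier B"
    by (auto simp: A_fin_gen_def)
  \<comment> \<open>Adding zero to the generators makes their number positive even when
    \<open>T\<close> is empty, since geometric equivalence concerns only
    \<open>n \<ge> 1\<close>.\<close>
  let ?T = "insert \<zero>\<^bsub>B\<^esub> T"
  obtain h where h: "bij_betw h {1..card ?T} ?T"
    using T(1) ex_bij_betw_nat_finite_1[of ?T] by auto
  let ?n = "card ?T" and ?p = "restrict h {1..card ?T}"
  have n: "?n \<ge> 1" using T(1) by (simp add: Suc_le_eq card_gt_0_iff del: card_insert_if)
  have im: "?p ` {1..?n} = ?T" using h by (simp add: bij_betw_def)
  have "h i \<in> carrier B" if "i \<in> {1..?n}" for i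
    using bij_betwE[OF h] that T(2) by (metis M.zero_closed insertE subsetD)
  then have p: "?p \<in> points ?n B" by (simp add: points_def)
  have "lie_span K B (emb B ` carrier A \<union> T) \<subseteq> lie_span K B (emb B ` carrier A \<union> ?T)"
    by (auto simp: lie_span_def)
  moreover have "coord_alg K A ?n B ?p \<subseteq> carrier B"
    unfolding coord_alg_def using poly_eval_closed[OF B p] by blast
  ultimately have "coord_alg K A ?n B ?p = carrier B"
    using coord_alg_eq_lie_span[OF B p] T(3) unfolding im by blast
  then show "\<exists>n\<ge>1. \<exists>p\<in>points n B. coord_alg K A n B p = carrier B"
    using n p by blast
next
  assume "\<exists>n\<ge>1. \<exists>p\<in>points n B. coord_alg K A n B p = carrier B"
  then obtain n p where p: "p \<in> points n B" "coord_alg K A n B p = carrier B" by blast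
  then show "A_fin_gen K A B"
    unfolding A_fin_gen_def
    by (intro exI[of _ "p ` {1..n}"]) (auto simp: coord_alg_eq_lie_span points_def B)
qed

section \<open>Kernels and factorization of homomorphisms\<close>

lemma lie_hom_minus:
  assumes L: "lie_algebra K L" and M: "lie_algebra K M" and h: "h \<in> lie_hom K L M"
    and x: "x \<in> carrier L" and y: "y \<in> carrier L"
  shows "h (x \<ominus>\<^bsub>L\<^esub> y) = h x \<ominus>\<^bsub>M\<^esub> h y"
proof -
  interpret L: lie_algebra K L by fact
  interpret M: lie_algebra K M by fact
  \<comment> \<open>\<open>lie_hom\<close> records no negatives, so they are written as multiples by
    the scalar minus one.\<close>
  have "h (\<ominus>\<^bsub>L\<^esub> y) = h ((\<ominus>\<^bsub>K\<^esub> \<one>\<^bsub>K\<^esub>) \<odot>\<^bsub>L\<^esub> y)" using y by (simp add: L.smult_l_minus)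
  also have "\<dots> = \<ominus>\<^bsub>M\<^esub> h y"
    using y lie_hom_closed[OF h y] by (simp add: lie_hom_smult[OF h] M.smult_l_minus)
  finally show ?thesis
    using x y by (simp add: a_minus_def lie_hom_add[OF h])
qed

lemma lie_hom_eq_iff_minus:
  assumes L: "lie_algebra K L" and M: "lie_algebra K M" and h: "h \<in> lie_hom K L M"
    and x: "x \<in> carrier L" and y: "y \<in> carrier L"
  shows "h x = h y \<longleftrightarrow> h (x \<ominus>\<^bsub>L\<^esub> y) = \<zero>\<^bsub>M\<^esub>"
proof -
  interpret M: lie_algebra K M by fact
  show ?thesis
    using lie_hom_closed[OF h x] lie_hom_closed[OF h y] unfolding lie_hom_minus[OF assms]
    by (metis M.M.add.inv_closed M.M.minus_eq M.M.minus_equality M.M.minus_minus M.M.r_neg)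
qed

text \<open>The first isomorphism theorem without quotients: the surjection \<open>s\<close>
  presents \<open>D\<close>, and \<open>t\<close> kills everything that \<open>s\<close>
  kills.\<close>

lemma A_hom_factor:
  assumes P: "A_lie_algebra K A P" and D: "A_lie_algebra K A D" and B: "A_lie_algebra K A B"
    and s: "s \<in> A_hom K A P D" and t: "t \<in> A_hom K A P B"
    and onto: "s ` carrier P = carrier D"
    and ker: "\<And>f. \<lbrakk>f \<in> carrier P; s f = \<zero>\<^bsub>D\<^esub>\<rbrakk> \<Longrightarrow> t f = \<zero>\<^bsub>B\<^esub>"
  shows "\<exists>g\<in>A_hom K A D B. \<forall>f\<in>carrier P. g (s f) = t f"
proof -
  note Ps = A_lie_algebraD[OF P] and Ds = A_lie_algebraD[OF D] and Bs = A_lie_algebraD[OF B]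
  note sl = A_homD(1)[OF s] and tl = A_homD(1)[OF t]
  interpret P: lie_algebra K P by (rule Ps)
  have wd: "t f = t f'" if "f \<in> carrier P" "f' \<in> carrier P" "s f = s f'" for f f'
    using that ker[of "f \<ominus>\<^bsub>P\<^esub> f'"]
    by (simp add: lie_hom_eq_iff_minus[OF Ps(2) Ds(2) sl] lie_hom_eq_iff_minus[OF Ps(2) Bs(2) tl])
  \<comment> \<open>A value of \<open>g\<close> is read off at an arbitrary preimage under
    \<open>s\<close>; by \<open>wd\<close> the choice does not matter.\<close>
  define g where "g d = t (inv_into (carrier P) s d)" for d
  have g: "g (s f) = t f" if "f \<in> carrier P" for f
    unfolding g_def using that by (intro wd inv_into_into f_inv_into_f) auto
  have "g \<in> lie_hom K D B"
    unfolding lie_hom_def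
    by (auto simp: onto[symmetric] lie_hom_add[OF sl, symmetric] lie_hom_smult[OF sl, symmetric]
        lie_hom_bracket[OF sl, symmetric] g lie_hom_add[OF tl] lie_hom_smult[OF tl]
        lie_hom_bracket[OF tl] lie_hom_closed[OF tl])
  moreover have "g (emb D a) = emb B a" if "a \<in> carrier A" for a
    using g[OF lie_hom_closed[OF Ps(3) that]] A_homD(2)[OF s that] A_homD(2)[OF t that] by simp
  ultimately show ?thesis using g by (auto simp: A_hom_def)
qed

section \<open>Radicals and embeddings in powers\<close>

text \<open>The ideal of polynomials vanishing at a single point. Within \<open>A[X]\<close>,
  \<open>lie_radical\<close> is the intersection of these ideals over the algebraic set.\<close>

definition eval_kernel ::
    "('k, 'm) ring_scheme \<Rightarrow> ('k, 'a, 'n) module_scheme \<Rightarrow> nat \<Rightarrow> ('k, 'a, 'b) lie_over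
      \<Rightarrow> (nat \<Rightarrow> 'b) \<Rightarrow> ('k, 'a) lie_poly set"
  where "eval_kernel K A n B p =
    {f \<in> carrier (lie_poly_algebra K A n). poly_eval K A n B f p = \<zero>\<^bsub>B\<^esub>}"

lemma lie_radical_extensive:
  "S \<subseteq> carrier (lie_poly_algebra K A n) \<Longrightarrow> S \<subseteq> lie_radical K A n B S"
  by (auto simp: lie_radical_def alg_set_def)

lemma lie_radical_mono:
  "S \<subseteq> S' \<Longrightarrow> lie_radical K A n B S \<subseteq> lie_radical K A n B S'"
  by (auto simp: lie_radical_def alg_set_def)

text \<open>Every zero of \<open>S\<close> is also a zero of its radical, by the definition of the
  radical.\<close>

lemma lie_radical_idem:
  "lie_radical K A n B (lie_radical K A n B S) \<subseteq> lie_radical K A n B S"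
  by (auto simp: lie_radical_def alg_set_def)

text \<open>An embedding in a power of \<open>B\<close> is a separating family of maps
  \<open>g i\<close> from \<open>D\<close> to \<open>B\<close>. Each sends \<open>p\<close> to a
  zero of the kernel, where a polynomial \<open>f\<close> of the radical vanishes. Hence every
  \<open>g i\<close> kills the value of \<open>f\<close> at \<open>p\<close>, and separation makes
  this value zero.\<close>

lemma embeds_in_prod_radical_subset:
  assumes D: "A_lie_algebra K A D" and B: "A_lie_algebra K A B"
    and p: "p \<in> points n D" and E: "embeds_in_prod I K A {B} D"
  shows "lie_radical K A n B (eval_kernel K A n D p) \<subseteq> eval_kernel K A n D p"
proof
  let ?S = "eval_kernel K A n D p"
  note Ds = A_lie_algebraD[OF D] and Bs = A_lie_algebraD[OF B]
  interpret D: lie_algebra K D by (rule Ds)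
  have "\<forall>B'\<in>{B}. A_lie_algebra K A B'" using B by simp
  from E[unfolded embeds_in_prod_iff[OF D this]] obtain F g where
    F: "\<forall>i\<in>I. F i \<in> {B} \<and> g i \<in> A_hom K A D (F i)"
    and sep: "\<And>x y. \<lbrakk>x \<in> carrier D; y \<in> carrier D; \<forall>i\<in>I. g i x = g i y\<rbrakk> \<Longrightarrow> x = y"
    by blast
  from F have g: "g i \<in> A_hom K A D B" if "i \<in> I" for i using that by auto
  fix f assume f: "f \<in> lie_radical K A n B ?S"
  then have fP: "f \<in> carrier (lie_poly_algebra K A n)" unfolding lie_radical_def by blast
  have "g i (poly_eval K A n D f p) = g i \<zero>\<^bsub>D\<^esub>" if i: "i \<in> I" for i
  proof -
    let ?q = "\<lambda>j\<in>{1..n}. g i (p j)"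
    note zero = lie_hom_zero[OF Ds(2) Bs(2) A_homD(1)[OF g[OF i]]]
    have "?q \<in> alg_set K A n B ?S"
      unfolding alg_set_def
    proof (intro CollectI conjI ballI points_map[OF p A_homD(1)[OF g[OF i]]])
      fix e assume "e \<in> ?S"
      then show "poly_eval K A n B e ?q = \<zero>\<^bsub>B\<^esub>"
        using poly_eval_map[OF D B p g[OF i], of e] zero unfolding eval_kernel_def by simp
    qed
    then have "poly_eval K A n B f ?q = \<zero>\<^bsub>B\<^esub>" using f unfolding lie_radical_def by blast
    then show ?thesis using zero poly_eval_map[OF D B p g[OF i] fP] by simp
  qed
  then have "poly_eval K A n D f p = \<zero>\<^bsub>D\<^esub>"
    by (intro sep poly_eval_closed[OF D p fP]) auto
  then show "f \<in> ?S" using fP by (simp add: eval_kernel_def)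
qed

text \<open>The zeros of the kernel in \<open>B\<close> index the power: each zero \<open>q\<close>
  gives an \<open>A\<close>-homomorphism from \<open>D\<close> to \<open>B\<close> sending
  \<open>p\<close> to \<open>q\<close>. If all of them identify the values of \<open>e\<close> and
  \<open>f\<close> at \<open>p\<close>, then the difference of \<open>e\<close> and \<open>f\<close>
  lies in the radical, hence in the kernel, and the two values coincide.\<close>

lemma radical_subset_embeds_in_prod:
  assumes D: "A_lie_algebra K A D" and B: "A_lie_algebra K A B"
    and p: "p \<in> points n D" and onto: "coord_alg K A n D p = carrier D"
    and rad: "lie_radical K A n B (eval_kernel K A n D p) \<subseteq> eval_kernel K A n D p"
  shows "embeds_in_prod (alg_set K A n B (eval_kernel K A n D p)) K A {B} D"
proof -
  let ?P = "lie_poly_algebra K A n"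
  let ?V = "alg_set K A n B (eval_kernel K A n D p)"
  note Ds = A_lie_algebraD[OF D] and Bs = A_lie_algebraD[OF B]
  note P = lie_poly_A_lie_algebra[OF Ds(1), of n]
  note ev = poly_eval_hom(1)[OF D p]
  interpret A: lie_algebra K A by (rule Ds)
  interpret D: lie_algebra K D by (rule Ds)
  interpret P: lie_algebra K ?P by (rule A_lie_algebraD[OF P])
  have "\<exists>g\<in>A_hom K A D B. \<forall>f\<in>carrier ?P. g (poly_eval K A n D f p) = poly_eval K A n B f q"
    if q: "q \<in> ?V" for q
  proof -
    have q': "q \<in> points n B" using q by (simp add: alg_set_def)
    show ?thesis
      by (rule A_hom_factor[OF P D B ev poly_eval_hom(1)[OF B q'] onto[unfolded coord_alg_def]])
         (use q in \<open>simp add: alg_set_def eval_kernel_def\<close>)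
  qed
  then obtain g where g: "\<And>q. q \<in> ?V \<Longrightarrow> g q \<in> A_hom K A D B"
    and gf: "\<And>q f. \<lbrakk>q \<in> ?V; f \<in> carrier ?P\<rbrakk> \<Longrightarrow>
      g q (poly_eval K A n D f p) = poly_eval K A n B f q"
    by metis
  have sep: "x = y" if xy: "x \<in> carrier D" "y \<in> carrier D" "\<forall>q\<in>?V. g q x = g q y" for x y
  proof -
    obtain e f where e: "e \<in> carrier ?P" "x = poly_eval K A n D e p"
      and f: "f \<in> carrier ?P" "y = poly_eval K A n D f p"
      using xy(1,2) unfolding onto[symmetric] coord_alg_def by blast
    have d: "e \<ominus>\<^bsub>?P\<^esub> f \<in> carrier ?P" using e f by (intro P.M.minus_closed)
    have "poly_eval K A n B (e \<ominus>\<^bsub>?P\<^esub> f) q = \<zero>\<^bsub>B\<^esub>" if q: "q \<in> ?V" for q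
    proof -
      have q': "q \<in> points n B" using q by (simp add: alg_set_def)
      have "poly_eval K A n B e q = poly_eval K A n B f q"
        using xy(3) q gf[OF q e(1)] gf[OF q f(1)] e(2) f(2) by metis
      then show ?thesis
        using lie_hom_eq_iff_minus[OF A_lie_algebraD(2)[OF P] Bs(2)
            A_homD(1)[OF poly_eval_hom(1)[OF B q']] e(1) f(1)] by simp
    qed
    then have "e \<ominus>\<^bsub>?P\<^esub> f \<in> eval_kernel K A n D p"
      using d by (intro subsetD[OF rad]) (simp add: lie_radical_def)
    then show ?thesis
      using lie_hom_eq_iff_minus[OF A_lie_algebraD(2)[OF P] Ds(2) A_homD(1)[OF ev] e(1) f(1)] e f
      by (simp add: eval_kernel_def)
  qed
  \<comment> \<open>With no zeros, separation holds vacuously and collapses \<open>D\<close> to one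
    element; injectivity of \<open>emb D\<close> then forces \<open>A\<close> to be zero.\<close>
  have "?V \<noteq> {} \<or> carrier A = {\<zero>\<^bsub>A\<^esub>}"
  proof (rule disjCI)
    assume "carrier A \<noteq> {\<zero>\<^bsub>A\<^esub>}"
    then obtain a where a: "a \<in> carrier A" "a \<noteq> \<zero>\<^bsub>A\<^esub>" using A.M.zero_closed by blast
    show "?V \<noteq> {}"
    proof
      assume "?V = {}"
      then have "emb D a = emb D \<zero>\<^bsub>A\<^esub>"
        using a by (intro sep lie_hom_closed[OF Ds(3)]) auto
      then show False using inj_onD[OF Ds(4)] a by blast
    qed
  qed
  moreover have "\<exists>F g. (\<forall>q\<in>?V. F q \<in> {B} \<and> g q \<in> A_hom K A D (F q)) \<and>
      (\<forall>x\<in>carrier D. \<forall>y\<in>carrier D. (\<forall>q\<in>?V. g q x = g q y) \<longrightarrow> x = y)"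
    using g sep by (intro exI[of _ "\<lambda>_. B"] exI[of _ g]) blast
  ultimately show ?thesis
    using B by (subst embeds_in_prod_iff[OF D]) blast+
qed

lemma A_pvar_iff_radical:
  fixes D :: "('k, 'a, 'u) lie_over"
  assumes D: "A_lie_algebra K A D" and B: "A_lie_algebra K A B"
    and p: "p \<in> points n D" and onto: "coord_alg K A n D p = carrier D"
  shows "D \<in> A_pvar K A {B} \<longleftrightarrow>
    lie_radical K A n B (eval_kernel K A n D p) \<subseteq> eval_kernel K A n D p"
proof
  assume "D \<in> A_pvar K A {B}"
  then show "lie_radical K A n B (eval_kernel K A n D p) \<subseteq> eval_kernel K A n D p"
    using embeds_in_prod_radical_subset[OF D B p] by (auto simp: A_pvar_def)
next
  assume "lie_radical K A n B (eval_kernel K A n D p) \<subseteq> eval_kernel K A n D p"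
  from radical_subset_embeds_in_prod[OF D B p onto this]
  \<comment> \<open>The index set just found consists of points of \<open>B\<close>, whereas
    \<open>A_pvar\<close> wants indices in \<open>'u\<close>, so the product is reindexed by
    elements of \<open>D\<close>.\<close>
  have "\<exists>J\<subseteq>carrier D. embeds_in_prod J K A {B} D"
    by (rule embeds_in_prod_index[OF D, rotated]) (simp add: B)
  then show "D \<in> A_pvar K A {B}" using D by (auto simp: A_pvar_def)
qed

section \<open>Coordinate algebras inside powers\<close>

lemma cart_prod_A_lie_algebra:
  assumes B: "\<And>i. i \<in> I \<Longrightarrow> A_lie_algebra K A (F i)" and I: "I \<noteq> {}"
  shows "A_lie_algebra K A (cart_prod I F)"
    and "\<And>i. i \<in> I \<Longrightarrow> (\<lambda>x. x i) \<in> A_hom K A (cart_prod I F) (F i)"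
proof -
  note Bs = A_lie_algebraD[OF B]
  \<comment> \<open>One coordinate already makes the diagonal map injective; it also supplies the
    facts about \<open>K\<close> and \<open>A\<close>.\<close>
  obtain i0 where i0: "i0 \<in> I" using I by blast
  have "field K" using Bs(1)[OF i0] by (simp add: lie_algebra_def)
  then have "lie_algebra K (cart_prod I F)"
    using Bs(2) by (rule cart_prod_lie_algebra)
  moreover have "emb (cart_prod I F) \<in> lie_hom K A (cart_prod I F)"
    by (auto simp: lie_hom_def cart_prod_def lie_hom_closed[OF Bs(3)] lie_hom_add[OF Bs(3)]
        lie_hom_smult[OF Bs(3)] lie_hom_bracket[OF Bs(3)] intro!: restrict_ext)
  moreover have "inj_on (emb (cart_prod I F)) (carrier A)"
  proof (rule inj_onI)
    fix x y assume xy: "x \<in> carrier A" "y \<in> carrier A" "emb (cart_prod I F) x = emb (cart_prod I F) y"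
    have "emb (F i0) x = emb (F i0) y"
      using fun_cong[OF xy(3), of i0] i0 by (simp add: cart_prod_def)
    then show "x = y" using inj_onD[OF Bs(4)[OF i0]] xy by blast
  qed
  ultimately show "A_lie_algebra K A (cart_prod I F)"
    using Bs(1)[OF i0] by (simp add: A_lie_algebra_def)
  show "(\<lambda>x. x i) \<in> A_hom K A (cart_prod I F) (F i)" if "i \<in> I" for i
    using that by (auto simp: A_hom_def lie_hom_def cart_prod_def)
qed

text \<open>Evaluation commutes with \<open>h\<close>, and an injective \<open>h\<close> kills only
  zero. This allows the kernel to be carried along inclusions and isomorphic copies.\<close>

lemma eval_kernel_inj:
  assumes B: "A_lie_algebra K A B" and C: "A_lie_algebra K A C"
    and p: "p \<in> points n B" and h: "h \<in> A_hom K A B C" and inj: "inj_on h (carrier B)"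
  shows "eval_kernel K A n C (\<lambda>i\<in>{1..n}. h (p i)) = eval_kernel K A n B p"
proof -
  interpret B: lie_algebra K B by (rule A_lie_algebraD(2)[OF B])
  have "h (poly_eval K A n B f p) = \<zero>\<^bsub>C\<^esub> \<longleftrightarrow> poly_eval K A n B f p = \<zero>\<^bsub>B\<^esub>"
    if "f \<in> carrier (lie_poly_algebra K A n)" for f
    using inj_on_eq_iff[OF inj poly_eval_closed[OF B p that] B.M.zero_closed]
      lie_hom_zero[OF A_lie_algebraD(2)[OF B] A_lie_algebraD(2)[OF C] A_homD(1)[OF h]] by simp
  then show ?thesis
    unfolding eval_kernel_def using poly_eval_map[OF B C p h]
    by (intro Collect_cong conj_cong) simp_all
qed

lemma coord_alg_map:
  assumes B: "A_lie_algebra K A B" and C: "A_lie_algebra K A C"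
    and p: "p \<in> points n B" and h: "h \<in> A_hom K A B C"
  shows "coord_alg K A n C (\<lambda>i\<in>{1..n}. h (p i)) = h ` coord_alg K A n B p"
  unfolding coord_alg_def image_image
  by (rule image_cong[OF HOL.refl poly_eval_map[OF assms]])

text \<open>
  The coordinate algebra \<open>A[X] / Rad(S)\<close> is realized as the image of \<open>A[X]\<close> in the power of
  \<open>C\<close> indexed by the algebraic set of \<open>S\<close>, and then copied into the universe \<open>'u\<close>. If that
  algebraic set is empty, the quotient is zero and \<open>A\<close> need not embed in it.
\<close>

lemma ex_coordinate_algebra:
  fixes C :: "('k, 'a, 'c) lie_over"
  assumes C: "A_lie_algebra K A C" and n: "n \<ge> 1" and V: "alg_set K A n C S \<noteq> {}"
    and inf: "infinite (UNIV :: 'u set)"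
    and K: "carrier K \<lesssim> (UNIV :: 'u set)" and A: "carrier A \<lesssim> (UNIV :: 'u set)"
  shows "\<exists>(D :: ('k, 'a, 'u) lie_over) p. A_lie_algebra K A D \<and> p \<in> points n D \<and>
    coord_alg K A n D p = carrier D \<and> eval_kernel K A n D p = lie_radical K A n C S"
proof -
  let ?P = "lie_poly_algebra K A n" and ?V = "alg_set K A n C S"
  let ?Q = "cart_prod ?V (\<lambda>_. C)"
  \<comment> \<open>The generic point of the algebraic set: its coordinates are the coordinate
    functions, so evaluating \<open>f\<close> at it lists the values of \<open>f\<close> at all
    points of \<open>?V\<close>.\<close>
  let ?r = "\<lambda>i\<in>{1..n}. \<lambda>v\<in>?V. v i"
  note P = lie_poly_A_lie_algebra[OF A_lie_algebraD(1)[OF C], of n]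
  note Q = cart_prod_A_lie_algebra[of ?V K A "\<lambda>_. C", OF C V]
  have Vp: "v \<in> points n C" if "v \<in> ?V" for v using that by (simp add: alg_set_def)
  have r: "?r \<in> points n ?Q"
    using Vp by (fastforce simp: points_def cart_prod_def)
  have ev: "poly_eval K A n ?Q f ?r v = poly_eval K A n C f v"
    if f: "f \<in> carrier ?P" and v: "v \<in> ?V" for f v
  proof -
    have "(\<lambda>i\<in>{1..n}. ?r i v) = v"
      using Vp[OF v] v by (auto simp: points_def PiE_iff extensional_def restrict_def fun_eq_iff)
    then show ?thesis using poly_eval_map[OF Q(1) C r Q(2)[OF v] f] by simp
  qed
  have "poly_eval K A n ?Q f ?r = \<zero>\<^bsub>?Q\<^esub> \<longleftrightarrow> (\<forall>v\<in>?V. poly_eval K A n C f v = \<zero>\<^bsub>C\<^esub>)"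
    if f: "f \<in> carrier ?P" for f
  proof -
    have "poly_eval K A n ?Q f ?r \<in> extensional ?V"
      using poly_eval_closed[OF Q(1) r f] by (simp add: cart_prod_def PiE_iff)
    then show ?thesis
      using ev[OF f] by (auto simp: cart_prod_def extensional_def restrict_def fun_eq_iff)
  qed
  then have ker: "eval_kernel K A n ?Q ?r = lie_radical K A n C S"
    unfolding eval_kernel_def lie_radical_def by auto
  \<comment> \<open>Cutting the power down to the subalgebra generated by \<open>A\<close> and the
    generic point makes evaluation surjective and leaves its kernel unchanged.\<close>
  let ?E = "?Q\<lparr>carrier := coord_alg K A n ?Q ?r\<rparr>"
  have sub: "A_subalgebra K A ?Q (coord_alg K A n ?Q ?r)"
    unfolding coord_alg_def by (rule A_hom_image_A_subalgebra[OF P Q(1) poly_eval_hom(1)[OF Q(1) r]])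
  note E = A_subalgebra_A_lie_algebra[OF Q(1) sub]
  have "?r i \<in> coord_alg K A n ?Q ?r" if "i \<in> {1..n}" for i
    unfolding coord_alg_eq_lie_span[OF Q(1) r] lie_span_def using that by blast
  then have rE: "?r \<in> points n ?E" by (auto simp: points_def)
  have rr: "(\<lambda>i\<in>{1..n}. ?r i) = ?r" by auto
  have kerE: "eval_kernel K A n ?E ?r = lie_radical K A n C S"
    using eval_kernel_inj[OF E(1) Q(1) rE E(2)] ker rr by (simp add: inj_on_def)
  have ontoE: "coord_alg K A n ?E ?r = carrier ?E"
    using coord_alg_map[OF E(1) Q(1) rE E(2)] rr by simp
  have "A_fin_gen K A ?E"
    unfolding A_fin_gen_iff_coord_alg[OF E(1)] using n rE ontoE by blast
  from fin_gen_copy[OF E(1) this inf K A] obtain D :: "('k, 'a, 'u) lie_over" and h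
    where D: "A_lie_algebra K A D" and h: "h \<in> A_iso K A ?E D"
    by blast
  have hh: "h \<in> A_hom K A ?E D" and inj: "inj_on h (carrier ?E)" and im: "h ` carrier ?E = carrier D"
    using h unfolding A_iso_def bij_betw_def by blast+
  have "(\<lambda>i\<in>{1..n}. h (?r i)) \<in> points n D" by (rule points_map[OF rE A_homD(1)[OF hh]])
  then show ?thesis
    using D eval_kernel_inj[OF E(1) D rE hh inj] coord_alg_map[OF E(1) D rE hh] kerE ontoE im
    by (intro exI[of _ D] exI[of _ "\<lambda>i\<in>{1..n}. h (?r i)"]) simp
qed

section \<open>Comparing radicals with prevarieties\<close>

lemma radical_subset_iff_pvar_subset:
  fixes K :: "('k, 'm) ring_scheme"
    and A :: "('k, 'a, 'n) module_scheme"
    and B :: "('k, 'a, 'b) lie_over"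
    and C :: "('k, 'a, 'c) lie_over"
  assumes B: "A_lie_algebra K A B" and C: "A_lie_algebra K A C"
    and inf: "infinite (UNIV :: 'u set)"
    and K: "carrier K \<lesssim> (UNIV :: 'u set)" and A: "carrier A \<lesssim> (UNIV :: 'u set)"
  shows "(\<forall>n\<ge>1. \<forall>S\<subseteq>carrier (lie_poly_algebra K A n).
      lie_radical K A n B S \<subseteq> lie_radical K A n C S) \<longleftrightarrow>
    (fin_gen_part K A (A_pvar K A {C}) :: ('k, 'a, 'u) lie_over set) \<subseteq>
      fin_gen_part K A (A_pvar K A {B})"
    (is "?rad \<longleftrightarrow> ?pvar")
proof
  assume rad: ?rad
  show ?pvar
  proof
    fix D :: "('k, 'a, 'u) lie_over"
    assume "D \<in> fin_gen_part K A (A_pvar K A {C})"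
    then have DC: "D \<in> A_pvar K A {C}" and D: "A_lie_algebra K A D" and fg: "A_fin_gen K A D"
      by (auto simp: fin_gen_part_def A_pvar_def)
    from fg obtain n p where n: "n \<ge> 1" and p: "p \<in> points n D"
      and onto: "coord_alg K A n D p = carrier D"
      unfolding A_fin_gen_iff_coord_alg[OF D] by blast
    have "eval_kernel K A n D p \<subseteq> carrier (lie_poly_algebra K A n)"
      unfolding eval_kernel_def by blast
    \<comment> \<open>Taking the kernel for \<open>S\<close>, its radical over \<open>B\<close> lies
      in its radical over \<open>C\<close>, which lies in the kernel.\<close>
    then have "D \<in> A_pvar K A {B}"
      using DC rad n unfolding A_pvar_iff_radical[OF D C p onto] A_pvar_iff_radical[OF D B p onto]
      by blast
    then show "D \<in> fin_gen_part K A (A_pvar K A {B})" using fg by (simp add: fin_gen_part_def)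
  qed
next
  assume pvar: ?pvar
  show ?rad
  proof (intro allI impI)
    fix n :: nat and S assume n: "n \<ge> 1" and S: "S \<subseteq> carrier (lie_poly_algebra K A n)"
    show "lie_radical K A n B S \<subseteq> lie_radical K A n C S"
    proof (cases "alg_set K A n C S = {}")
      case True
      \<comment> \<open>Without zeros in \<open>C\<close>, the radical over \<open>C\<close> is all
        of \<open>A[X]\<close>.\<close>
      then show ?thesis by (auto simp: lie_radical_def)
    next
      case False
      from ex_coordinate_algebra[OF C n this inf K A] obtain D :: "('k, 'a, 'u) lie_over" and p
        where D: "A_lie_algebra K A D" and p: "p \<in> points n D"
          and onto: "coord_alg K A n D p = carrier D"
          and ker: "eval_kernel K A n D p = lie_radical K A n C S"
        by blast
      have "A_fin_gen K A D" unfolding A_fin_gen_iff_coord_alg[OF D] using n p onto by blast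
      moreover have "D \<in> A_pvar K A {C}"
        unfolding A_pvar_iff_radical[OF D C p onto] ker by (rule lie_radical_idem)
      ultimately have "D \<in> A_pvar K A {B}" using pvar by (auto simp: fin_gen_part_def)
      then have "lie_radical K A n B (lie_radical K A n C S) \<subseteq> lie_radical K A n C S"
        unfolding A_pvar_iff_radical[OF D B p onto] ker .
      \<comment> \<open>\<open>S\<close> lies in its radical over \<open>C\<close>, so monotonicity
        bounds the radical of \<open>S\<close> over \<open>B\<close> by the left side of the
        previous inclusion.\<close>
      then show ?thesis
        using lie_radical_mono[OF lie_radical_extensive[OF S, where B = C], where B = B] by blast
    qed
  qed
qed

theorem lemma12p1:
  fixes K :: "('k, 'm) ring_scheme"
    and A :: "('k, 'a, 'n) module_scheme"
    and B :: "('k, 'a, 'b) lie_over"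
    and C :: "('k, 'a, 'c) lie_over"
  assumes "field K"
    and "lie_algebra K A"
    and "A_lie_algebra K A B"
    and "A_lie_algebra K A C"
    and "infinite (UNIV :: 'u set)"
    and "carrier K \<lesssim> (UNIV :: 'u set)"
    and "carrier A \<lesssim> (UNIV :: 'u set)"
  shows "geom_equivalent K A B C \<longleftrightarrow>
    (fin_gen_part K A (A_pvar K A {B}) :: ('k, 'a, 'u) lie_over set) =
     fin_gen_part K A (A_pvar K A {C})"
  \<comment> \<open>Both equalities split into two inclusions, matched by the preceding lemma with
    \<open>B\<close> and \<open>C\<close> in both orders.\<close>
  unfolding set_eq_subset[of "fin_gen_part _ _ _"]
    radical_subset_iff_pvar_subset[OF assms(3,4,5,6,7), symmetric]
    radical_subset_iff_pvar_subset[OF assms(4,3,5,6,7), symmetric]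
    geom_equivalent_def
  by blast

end
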